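(* Let $m\ge 38$ and let $G$ be a finite simple graph with exactly $m$ edges, with no isolated vertices, which does not contain $C_6^{\triangle}$ as a (not necessarily induced) subgraph. Then $$\lambda(G)\le 1+\sqrt{m-2}.$$ Moreover, equality holds if and only if $G\cong K_3\nabla \frac{m-3}{3}K_1$.
   Context: All graphs are finite and simple. $\lambda(G)$ denotes the spectral radius of $G$, i.e. the largest modulus of an eigenvalue of the adjacency matrix of $G$. $C_6^{\triangle}$ is the graph on $7$ vertices obtained from the cycle $C_6$ by adding one new vertex joined to exactly two adjacent vertices of $C_6$. $G\nabla H$ denotes the join of $G$ and $H$ (disjoint union plus all edges between $V(G)$ and $V(H)$), and $tK_1$ is the edgeless graph on $t$ vertices. The graph $K_3\nabla\frac{m-3}{3}K_1$ is defined only when $3$ divides $m$; when $3\nmid m$, no graph is isomorphic to it. *)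

theory Defs
  imports
    "Graph_Theory.Pair_Digraph"
    "Graph_Theory.Digraph_Component"
    "Graph_Theory.Digraph_Isomorphism"
    "Jordan_Normal_Form.Spectral_Radius"
begin

text \<open>
  A finite simple graph is a \<^term>\<open>pair_graph\<close>: a finite vertex set with a finite, loop-free,
  symmetric set of arcs. Every undirected edge is thus represented by two opposite arcs,
  so edges are counted as two-element sets.
\<close>

definition uedges :: "'a pair_pre_digraph \<Rightarrow> 'a set set" where
  "uedges G = {{u, v} | u v. (u, v) \<in> parcs G}"

definition isolated :: "'a pair_pre_digraph \<Rightarrow> 'a \<Rightarrow> bool" where
  "isolated G v \<longleftrightarrow> v \<in> pverts G \<and> (\<forall>u. (v, u) \<notin> parcs G)"

definition graph_iso :: "'a pair_pre_digraph \<Rightarrow> 'b pair_pre_digraph \<Rightarrow> bool" where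
  "graph_iso G H \<longleftrightarrow> digraph_iso (with_proj G) (with_proj H)"

lemma graph_iso_iff:
  assumes "pair_wf_digraph G"
  shows "graph_iso G H \<longleftrightarrow>
    (\<exists>f. bij_betw f (pverts G) (pverts H) \<and> parcs H = map_prod f f ` parcs G)"
proof
  assume "graph_iso G H"
  then obtain h where h: "pre_digraph.digraph_isomorphism (with_proj G) h"
      "with_proj H = app_iso h (with_proj G)"
    unfolding graph_iso_def digraph_iso_def by blast
  have eqs: "pverts H = iso_verts h ` pverts G" "parcs H = iso_arcs h ` parcs G"
      "iso_tail h = fst" "iso_head h = snd"
    using h(2) unfolding with_proj_def app_iso_def by auto
  have "iso_arcs h a = map_prod (iso_verts h) (iso_verts h) a" if "a \<in> parcs G" for a
    using h(1) that unfolding pre_digraph.digraph_isomorphism_def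
    by (auto simp: eqs prod_eq_iff)
  then show "\<exists>f. bij_betw f (pverts G) (pverts H) \<and> parcs H = map_prod f f ` parcs G"
    using h(1) eqs unfolding pre_digraph.digraph_isomorphism_def bij_betw_def
    by (intro exI[of _ "iso_verts h"]) (auto intro!: image_cong)
next
  assume "\<exists>f. bij_betw f (pverts G) (pverts H) \<and> parcs H = map_prod f f ` parcs G"
  then obtain f where f: "inj_on f (pverts G)" "pverts H = f ` pverts G"
      "parcs H = map_prod f f ` parcs G" by (auto simp: bij_betw_def)
  interpret pair_wf_digraph G by fact
  have "inj_on (map_prod f f) (parcs G)"
    using map_prod_inj_on[OF f(1) f(1)]
    by (rule inj_on_subset) (auto dest: in_arcsD1 in_arcsD2)
  with f show "graph_iso G H"
    unfolding graph_iso_def digraph_iso_def pre_digraph.digraph_isomorphism_def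
    by (intro exI[of _ "\<lparr>iso_verts = f, iso_arcs = map_prod f f, iso_head = snd, iso_tail = fst\<rparr>"])
      (use assms in \<open>simp add: wf_digraph_wp_iff; simp add: with_proj_def app_iso_def\<close>)
qed

definition contains_copy :: "'a pair_pre_digraph \<Rightarrow> 'b pair_pre_digraph \<Rightarrow> bool" where
  "contains_copy G F \<longleftrightarrow>
    (\<exists>H :: 'a pair_pre_digraph. subgraph (with_proj H) (with_proj G) \<and> graph_iso H F)"

definition complete_graph :: "nat \<Rightarrow> nat pair_pre_digraph" where
  "complete_graph n =
    \<lparr>pverts = {..<n}, parcs = {(i, j). i < n \<and> j < n \<and> i \<noteq> j}\<rparr>"

definition edgeless_graph :: "nat \<Rightarrow> nat pair_pre_digraph" where
  "edgeless_graph n = \<lparr>pverts = {..<n}, parcs = {}\<rparr>"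

definition cycle_graph :: "nat \<Rightarrow> nat pair_pre_digraph" where
  "cycle_graph n =
    \<lparr>pverts = {..<n},
     parcs = {(i, j). i < n \<and> j < n \<and> (j = (i + 1) mod n \<or> i = (j + 1) mod n)}\<rparr>"

definition graph_join ::
    "'a pair_pre_digraph \<Rightarrow> 'b pair_pre_digraph \<Rightarrow> ('a + 'b) pair_pre_digraph" where
  "graph_join G H =
    \<lparr>pverts = pverts G <+> pverts H,
     parcs = map_prod Inl Inl ` parcs G \<union> map_prod Inr Inr ` parcs H
       \<union> {(Inl u, Inr v) | u v. u \<in> pverts G \<and> v \<in> pverts H}
       \<union> {(Inr v, Inl u) | u v. u \<in> pverts G \<and> v \<in> pverts H}\<rparr>"

definition C6_triangle :: "nat pair_pre_digraph" where
  "C6_triangle =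
    \<lparr>pverts = insert 6 (pverts (cycle_graph 6)),
     parcs = parcs (cycle_graph 6) \<union> {(6, 0), (0, 6), (6, 1), (1, 6)}\<rparr>"

lemma pair_graph_C6_triangle: "pair_graph C6_triangle"
proof -
  have "finite {(i, j). i < 6 \<and> j < 6 \<and> P i j}" for P :: "nat \<Rightarrow> nat \<Rightarrow> bool"
    by (rule finite_subset[of _ "{..<6} \<times> {..<6}"]) auto
  moreover have "i \<noteq> Suc i mod 6" "Suc i mod 6 \<noteq> i" for i :: nat by presburger+
  ultimately show ?thesis
    unfolding C6_triangle_def cycle_graph_def
    by unfold_locales (auto simp: symmetric_def with_proj_def arcs_ends_def arc_to_ends_def intro!: symI)
qed

definition adjacency_mat :: "'a list \<Rightarrow> 'a pair_pre_digraph \<Rightarrow> complex mat" where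
  "adjacency_mat vs G =
    mat (length vs) (length vs) (\<lambda>(i, j). if (vs ! i, vs ! j) \<in> parcs G then 1 else 0)"

text \<open>
  The rows and columns of a matrix are indexed by numbers, so an enumeration of the vertices has
  to be chosen. The lemma \<open>graph_spectral_radius_eq\<close> below shows that the choice is immaterial.
\<close>

definition graph_spectral_radius :: "'a pair_pre_digraph \<Rightarrow> real" where
  "graph_spectral_radius G =
    spectral_radius (adjacency_mat (SOME vs. distinct vs \<and> set vs = pverts G) G)"

lemma eigenvalue_adjacency_mat_iff:
  assumes "distinct vs" and "set vs = V"
  shows "eigenvalue (adjacency_mat vs G) k \<longleftrightarrow>
    (\<exists>f. (\<exists>v\<in>V. f v \<noteq> 0) \<and> (\<forall>v\<in>V. (\<Sum>u\<in>V. if (v, u) \<in> parcs G then f u else 0) = k * f v))"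
    (is "?L \<longleftrightarrow> ?R")
proof -
  define n where "n = length vs"
  have bij: "bij_betw ((!) vs) {..<n} V"
    using assms unfolding n_def by (intro bij_betw_nth) auto
  have mv: "(adjacency_mat vs G *\<^sub>v x) $ i
      = (\<Sum>j<n. if (vs ! i, vs ! j) \<in> parcs G then x $ j else 0)"
    if "i < n" "x \<in> carrier_vec n" for i x
    using that unfolding adjacency_mat_def n_def
    by (auto simp: scalar_prod_def atLeast0LessThan intro!: sum.cong)
  have dim: "dim_row (adjacency_mat vs G) = n"
    by (simp add: adjacency_mat_def n_def)
  show ?thesis
  proof
    assume ?L
    then obtain x where x: "x \<in> carrier_vec n" "x \<noteq> 0\<^sub>v n"
        "adjacency_mat vs G *\<^sub>v x = k \<cdot>\<^sub>v x"
      unfolding eigenvalue_def eigenvector_def dim by auto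
    define f where "f v = x $ inv_into {..<n} ((!) vs) v" for v
    have f: "f (vs ! i) = x $ i" if "i < n" for i
      using that bij unfolding f_def by (simp add: bij_betw_inv_into_left)
    obtain i where i: "i < n" "x $ i \<noteq> 0"
      using x(1,2) by (metis carrier_vecD eq_vecI index_zero_vec(1) index_zero_vec(2))
    have "\<exists>v\<in>V. f v \<noteq> 0"
      using i f bij by (intro bexI[of _ "vs ! i"]) (auto simp: bij_betw_def)
    moreover have "(\<Sum>u\<in>V. if (v, u) \<in> parcs G then f u else 0) = k * f v" if v: "v \<in> V" for v
    proof -
      from v bij obtain i where i: "i < n" "v = vs ! i" by (auto simp: bij_betw_def)
      have "(\<Sum>u\<in>V. if (v, u) \<in> parcs G then f u else 0)
          = (\<Sum>j<n. if (v, vs ! j) \<in> parcs G then f (vs ! j) else 0)"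
        by (rule sum.reindex_bij_betw[OF bij, symmetric])
      also have "\<dots> = (adjacency_mat vs G *\<^sub>v x) $ i"
        using mv[OF i(1) x(1)] i by (auto simp: f intro!: sum.cong)
      also have "\<dots> = k * f v" using x i f by simp
      finally show ?thesis .
    qed
    ultimately show ?R by blast
  next
    assume ?R
    then obtain f where f: "\<exists>v\<in>V. f v \<noteq> 0"
        "\<And>v. v \<in> V \<Longrightarrow> (\<Sum>u\<in>V. if (v, u) \<in> parcs G then f u else 0) = k * f v" by blast
    define x where "x = vec n (\<lambda>i. f (vs ! i))"
    have x: "x \<in> carrier_vec n" by (simp add: x_def)
    have "x \<noteq> 0\<^sub>v n"
    proof
      assume "x = 0\<^sub>v n"
      then have "f (vs ! i) = 0" if "i < n" for i
        using that unfolding x_def by (metis index_vec index_zero_vec(1))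
      then show False using f(1) bij by (auto simp: bij_betw_def)
    qed
    moreover have "adjacency_mat vs G *\<^sub>v x = k \<cdot>\<^sub>v x"
    proof (rule eq_vecI)
      fix i assume "i < dim_vec (k \<cdot>\<^sub>v x)"
      then have i: "i < n" by (simp add: x_def)
      have "(adjacency_mat vs G *\<^sub>v x) $ i
          = (\<Sum>j<n. if (vs ! i, vs ! j) \<in> parcs G then f (vs ! j) else 0)"
        unfolding mv[OF i x] by (auto simp: x_def intro!: sum.cong)
      also have "\<dots> = (\<Sum>u\<in>V. if (vs ! i, u) \<in> parcs G then f u else 0)"
        by (rule sum.reindex_bij_betw[OF bij])
      also have "\<dots> = k * f (vs ! i)"
        using i bij by (intro f(2)) (auto simp: bij_betw_def)
      finally show "(adjacency_mat vs G *\<^sub>v x) $ i = (k \<cdot>\<^sub>v x) $ i"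
        using i by (simp add: x_def)
    qed (simp add: x_def dim)
    ultimately show ?L unfolding eigenvalue_def eigenvector_def dim using x by blast
  qed
qed

lemma graph_spectral_radius_eq:
  assumes "distinct vs" and "set vs = pverts G"
  shows "graph_spectral_radius G = spectral_radius (adjacency_mat vs G)"
proof -
  have "distinct (SOME vs. distinct vs \<and> set vs = pverts G)
      \<and> set (SOME vs. distinct vs \<and> set vs = pverts G) = pverts G"
    by (rule someI_ex) (use assms in blast)
  then have "eigenvalue (adjacency_mat (SOME vs. distinct vs \<and> set vs = pverts G) G)
      = eigenvalue (adjacency_mat vs G)"
    using assms by (intro ext) (simp only: eigenvalue_adjacency_mat_iff)
  then show ?thesis
    unfolding graph_spectral_radius_def spectral_radius_def spectrum_def by simp
qed

end

theory Submission
  imports Defs "HOL-Analysis.Function_Topology"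
begin

text \<open>
  Let \<open>l\<close> be the spectral radius and assume \<open>l \<ge> 1 + sqrt (m - 2)\<close>; since \<open>m \<ge> 38\<close>, this forces
  \<open>l \<ge> 7\<close>. It suffices to show that then equality holds and that the graph is the join of a
  triangle with an independent set.

  Maximising the quadratic form of the adjacency relation over nonnegative unit vectors gives a
  nonnegative eigenvector for \<open>l\<close> (\<open>perron_vector\<close>). Scale it to a vector \<open>x\<close> whose largest entry is
  \<open>x u = 1\<close>. Let \<open>A\<close> be the neighbourhood of \<open>u\<close> and \<open>B\<close> the set of the other vertices. Evaluating
  \<open>l\<^sup>2 - 2 * l\<close> at \<open>u\<close> counts walks of length two and subtracts twice the walks of length one, and
  comparing with \<open>m - 3\<close>, that is, with the number of edges minus three, leaves (\<open>sum_excess\<close>)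
  the following: the excesses
  \<open>(d v - 2) * x v - d v / 2 - (\<Sum>w. 1 - x w)\<close> of the vertices \<open>v\<close> of \<open>A\<close> have sum at least
  \<open>e(B) - 3\<close>. Here \<open>d v\<close> is the degree of \<open>v\<close> inside \<open>A\<close>, and \<open>w\<close> runs over the neighbours of \<open>v\<close> in
  \<open>B\<close>. The choice of the number 2 is explained by the extremal graph, in which \<open>A\<close> is the
  join of an edge with an independent set and nearly all its vertices have degree 2 inside \<open>A\<close>.

  A path on six vertices inside \<open>A\<close> would form the forbidden graph together with \<open>u\<close>. Hence every
  connected component of \<open>A\<close> has a very rigid structure, and three cases bound its total excess.
  A component with a five-cycle has only these five vertices (\<open>C5_case\<close>). In a component with a
  four-cycle but no five-cycle, all remaining vertices hang on an opposite pair of that cycle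
  (\<open>C4_case\<close>). A component with neither has few edges because it is 2-degenerate (\<open>sparse_case\<close>).
  The upshot is that a component either has excess at most \<open>- (\<Sum>v. x v)\<close>, as stars and single
  vertices do, or excess at most \<open>-2\<close>, with more precise information in the latter case. The
  only components for which this needs an additional argument are those with at least
  nine edges on five vertices, whose excess could be close to zero. For them, the forbidden
  graph shows that every outer neighbour is attached to a single vertex of the neighbourhood of \<open>u\<close>,
  so its entry is small, and therefore the entries on the component are small too (\<open>near_K5_drop\<close>).

  Since the entries of \<open>x\<close> on \<open>A\<close> have sum \<open>l \<ge> 7\<close>, adding up shows that the total excess is below
  \<open>-3\<close>, except when \<open>A\<close> is a single component that is the join of an edge with an independent set
  (\<open>sum_excess_A\<close>). In this case there is equality, so \<open>B\<close> has no edges, and a vertex of \<open>B\<close>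
  would have entry 1 and be adjacent to all of \<open>A\<close>, which again produces the forbidden graph
  (\<open>eigenvalue_bound\<close>). Conversely, an explicit positive eigenvector shows that the extremal graph
  attains the bound (\<open>spectral_radius_K3_tK1_ge\<close>).
\<close>

section \<open>Adjacency relations on finite sets\<close>

locale simple_graph =
  fixes V :: "'a set" and adj :: "'a \<Rightarrow> 'a \<Rightarrow> bool" (infix "\<sim>" 50)
  assumes finite_V: "finite V"
    and adj_sym: "a \<sim> b \<Longrightarrow> b \<sim> a"
    and adj_irrefl: "\<not> a \<sim> a"
    and adj_V: "a \<sim> b \<Longrightarrow> a \<in> V"
begin

definition nbs :: "'a set \<Rightarrow> 'a \<Rightarrow> 'a set" where
  "nbs S v = {w \<in> S. v \<sim> w}"

abbreviation dg :: "'a set \<Rightarrow> 'a \<Rightarrow> nat" where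
  "dg S v \<equiv> card (nbs S v)"

text \<open>The degree sum of an induced subgraph is twice its number of edges. Using it instead of the
  latter keeps all edge counts in sums over vertices.\<close>
definition degsum :: "'a set \<Rightarrow> nat" where
  "degsum S = (\<Sum>v\<in>S. dg S v)"

text \<open>\<open>a b c d e f\<close> is the hexagon and \<open>t\<close> is the apex of the triangle on its edge \<open>ab\<close>.\<close>
definition has_C6T :: bool where
  "has_C6T \<longleftrightarrow> (\<exists>a b c d e f t. distinct [a, b, c, d, e, f, t] \<and>
     a \<sim> b \<and> b \<sim> c \<and> c \<sim> d \<and> d \<sim> e \<and> e \<sim> f \<and> f \<sim> a \<and> t \<sim> a \<and> t \<sim> b)"

definition has_P6 :: "'a set \<Rightarrow> bool" where
  "has_P6 S \<longleftrightarrow> (\<exists>a b c d e f. {a, b, c, d, e, f} \<subseteq> S \<and> distinct [a, b, c, d, e, f] \<and>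
     a \<sim> b \<and> b \<sim> c \<and> c \<sim> d \<and> d \<sim> e \<and> e \<sim> f)"

definition has_C5 :: "'a set \<Rightarrow> bool" where
  "has_C5 S \<longleftrightarrow> (\<exists>a b c d e. {a, b, c, d, e} \<subseteq> S \<and> distinct [a, b, c, d, e] \<and>
     a \<sim> b \<and> b \<sim> c \<and> c \<sim> d \<and> d \<sim> e \<and> e \<sim> a)"

definition has_C4 :: "'a set \<Rightarrow> bool" where
  "has_C4 S \<longleftrightarrow> (\<exists>a b c d. {a, b, c, d} \<subseteq> S \<and> distinct [a, b, c, d] \<and>
     a \<sim> b \<and> b \<sim> c \<and> c \<sim> d \<and> d \<sim> a)"

lemma has_C6TI:
  "\<lbrakk>distinct [a, b, c, d, e, f, t]; a \<sim> b; b \<sim> c; c \<sim> d; d \<sim> e; e \<sim> f; f \<sim> a; t \<sim> a; t \<sim> b\<rbrakk> \<Longrightarrow> has_C6T"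
  unfolding has_C6T_def by blast

lemma has_P6I:
  "\<lbrakk>{a, b, c, d, e, f} \<subseteq> S; distinct [a, b, c, d, e, f]; a \<sim> b; b \<sim> c; c \<sim> d; d \<sim> e; e \<sim> f\<rbrakk> \<Longrightarrow> has_P6 S"
  unfolding has_P6_def by blast

lemma has_C5I:
  "\<lbrakk>{a, b, c, d, e} \<subseteq> S; distinct [a, b, c, d, e]; a \<sim> b; b \<sim> c; c \<sim> d; d \<sim> e; e \<sim> a\<rbrakk> \<Longrightarrow> has_C5 S"
  unfolding has_C5_def by blast

lemma has_C4I:
  "\<lbrakk>{a, b, c, d} \<subseteq> S; distinct [a, b, c, d]; a \<sim> b; b \<sim> c; c \<sim> d; d \<sim> a\<rbrakk> \<Longrightarrow> has_C4 S"
  unfolding has_C4_def by blast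

lemma has_P6E:
  assumes "has_P6 S"
  obtains a b c d e f where "{a, b, c, d, e, f} \<subseteq> S" "distinct [a, b, c, d, e, f]"
     "a \<sim> b" "b \<sim> c" "c \<sim> d" "d \<sim> e" "e \<sim> f"
  using assms unfolding has_P6_def by (elim exE conjE) (rule that)

lemma has_C5E:
  assumes "has_C5 S"
  obtains a b c d e where "{a, b, c, d, e} \<subseteq> S" "distinct [a, b, c, d, e]"
     "a \<sim> b" "b \<sim> c" "c \<sim> d" "d \<sim> e" "e \<sim> a"
  using assms unfolding has_C5_def by (elim exE conjE) (rule that)

lemma has_C4E:
  assumes "has_C4 S"
  obtains a b c d where "{a, b, c, d} \<subseteq> S" "distinct [a, b, c, d]"
     "a \<sim> b" "b \<sim> c" "c \<sim> d" "d \<sim> a"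
  using assms unfolding has_C4_def by (elim exE conjE) (rule that)

lemma has_mono:
  assumes "S \<subseteq> T"
  shows "has_P6 S \<Longrightarrow> has_P6 T" "has_C5 S \<Longrightarrow> has_C5 T" "has_C4 S \<Longrightarrow> has_C4 T"
  using assms unfolding has_P6_def has_C5_def has_C4_def by (meson order_trans)+

lemma adj_neq: "a \<sim> b \<Longrightarrow> a \<noteq> b"
  using adj_irrefl by blast

lemma adj_commute: "a \<sim> b \<longleftrightarrow> b \<sim> a"
  using adj_sym by blast

lemma finite_nbs: "finite S \<Longrightarrow> finite (nbs S v)"
  unfolding nbs_def by simp

lemma dg_le_card_minus: "\<lbrakk>finite S; v \<in> S\<rbrakk> \<Longrightarrow> dg S v \<le> card S - 1"
  using card_mono[of "S - {v}" "nbs S v"] adj_irrefl by (auto simp: nbs_def)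

lemma double_count_edges:
  assumes "finite S" "finite T"
  shows "(\<Sum>v\<in>S. dg T v) = (\<Sum>w\<in>T. dg S w)"
proof -
  have "(\<Sum>v\<in>S. dg T v) = (\<Sum>v\<in>S. \<Sum>w\<in>T. if v \<sim> w then 1 else 0)"
    using assms by (simp add: nbs_def sum.If_cases Int_def)
  also have "\<dots> = (\<Sum>w\<in>T. \<Sum>v\<in>S. if v \<sim> w then 1 else 0)"
    by (rule sum.swap)
  also have "\<dots> = (\<Sum>w\<in>T. dg S w)"
    using assms by (simp add: nbs_def sum.If_cases Int_def adj_commute)
  finally show ?thesis .
qed

lemma dg_Un:
  assumes "finite S" "finite T" "S \<inter> T = {}"
  shows "dg (S \<union> T) v = dg S v + dg T v"
proof -
  have "nbs (S \<union> T) v = nbs S v \<union> nbs T v" by (auto simp: nbs_def)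
  then show ?thesis using assms by (auto simp: nbs_def intro!: card_Un_disjoint)
qed

lemma degsum_Un:
  assumes "finite S" "finite T" "S \<inter> T = {}"
  shows "degsum (S \<union> T) = degsum S + 2 * (\<Sum>v\<in>S. dg T v) + degsum T"
proof -
  have "degsum (S \<union> T) = (\<Sum>v\<in>S. dg (S \<union> T) v) + (\<Sum>v\<in>T. dg (S \<union> T) v)"
    unfolding degsum_def using assms by (rule sum.union_disjoint)
  then show ?thesis
    using assms double_count_edges[OF assms(1,2)] by (simp add: dg_Un degsum_def sum.distrib)
qed

lemma degsum_remove:
  assumes "finite S" "v \<in> S"
  shows "degsum S = degsum (S - {v}) + 2 * dg S v"
proof -
  have "degsum ({v} \<union> (S - {v})) = degsum {v} + 2 * (\<Sum>w\<in>{v}. dg (S - {v}) w) + degsum (S - {v})"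
    using assms by (intro degsum_Un) auto
  moreover have "{v} \<union> (S - {v}) = S" using assms by auto
  moreover have "nbs {v} v = {}" "nbs (S - {v}) v = nbs S v" using adj_irrefl by (auto simp: nbs_def)
  ultimately show ?thesis by (simp add: degsum_def)
qed

lemma degsum_le: "finite S \<Longrightarrow> degsum S \<le> card S * (card S - 1)"
  unfolding degsum_def using sum_bounded_above[of S "dg S" "card S - 1"] dg_le_card_minus by auto

lemma two_le_dg:
  assumes "finite S" "s \<noteq> t" "{s, t} \<subseteq> S" "v \<sim> s" "v \<sim> t"
  shows "2 \<le> dg S v"
proof -
  have "{s, t} \<subseteq> nbs S v" using assms by (auto simp: nbs_def)
  then show ?thesis using card_mono[of "nbs S v" "{s, t}"] finite_nbs assms(1,2) by simp
qed

lemma even_degsum: "finite S \<Longrightarrow> even (degsum S)"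
proof (induction S rule: finite_induct)
  case empty then show ?case by (simp add: degsum_def)
next
  case (insert v S)
  then show ?case using degsum_remove[of "insert v S" v] by simp
qed

lemma nb_outside:
  assumes "card X < dg S v" "finite X"
  obtains w where "w \<in> S" "v \<sim> w" "w \<notin> X"
proof -
  have "\<not> nbs S v \<subseteq> X" using assms card_mono[of X "nbs S v"] by linarith
  then show ?thesis using that by (auto simp: nbs_def)
qed

section \<open>Graphs without cycles of length at least four are sparse\<close>

text \<open>If all degrees were at least 3, a path could be extended greedily: its end has a neighbour
  other than the two preceding vertices, and since it closes no four- or five-cycle this neighbour
  is new. After six vertices this contradicts the absence of a path on six vertices.\<close>
lemma exists_degree_le_2:
  assumes F: "finite F" "F \<noteq> {}" and free: "\<not> has_P6 F" "\<not> has_C5 F" "\<not> has_C4 F"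
  shows "\<exists>v\<in>F. dg F v \<le> 2"
proof (rule ccontr)
  assume "\<not> ?thesis"
  then have deg: "2 < dg F v" if "v \<in> F" for v using that by force
  have ext: "\<exists>w. w \<in> F \<and> v \<sim> w \<and> w \<notin> {a, b}" if "v \<in> F" for v a b
  proof -
    have "card {a, b} \<le> 2" by (simp add: card_insert_if)
    then have "card {a, b} < dg F v" using deg[OF that] by linarith
    then show ?thesis using nb_outside[of "{a, b}" F v] by blast
  qed
  from F obtain p where p: "p \<in> F" by blast
  obtain q where q: "q \<in> F" "p \<sim> q" using ext[OF p] by blast
  obtain r where r: "r \<in> F" "q \<sim> r" "r \<noteq> p" using ext[OF q(1), of p p] by blast
  obtain s where s: "s \<in> F" "r \<sim> s" "s \<noteq> p" "s \<noteq> q" using ext[OF r(1), of p q] by blast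
  have neq: "p \<noteq> q" "q \<noteq> r" "r \<noteq> s" using q r s adj_neq by auto
  have "\<not> s \<sim> p" using free(3) has_C4I[of p q r s F] p q r s neq by auto
  then obtain t where t: "t \<in> F" "s \<sim> t" "t \<noteq> r" "t \<noteq> q" "t \<noteq> p"
    using ext[OF s(1), of r q] by blast
  have neq': "s \<noteq> t" using t adj_neq by auto
  have "\<not> t \<sim> q" using free(3) has_C4I[of q r s t F] q r s t neq neq' by auto
  moreover have "\<not> t \<sim> p" using free(2) has_C5I[of p q r s t F] p q r s t neq neq' by auto
  ultimately obtain w where w: "w \<in> F" "t \<sim> w" "w \<noteq> s" "w \<noteq> r" "w \<noteq> q" "w \<noteq> p"
    using ext[OF t(1), of s r] by blast
  have "t \<noteq> w" using w adj_neq by auto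
  then show False using free(1) has_P6I[of p q r s t w F] p q r s t w neq neq' by auto
qed

lemma degsum_four_le:
  assumes F: "card F = 4" and free: "\<not> has_P6 F" "\<not> has_C5 F" "\<not> has_C4 F"
  shows "degsum F \<le> 8"
proof -
  have fin: "finite F" using F by (metis card.infinite zero_neq_numeral)
  moreover have "F \<noteq> {}" using F by auto
  ultimately obtain v where v: "v \<in> F" "dg F v \<le> 2"
    using exists_degree_le_2 free by blast
  let ?S = "F - {v}"
  have c3: "card ?S = 3" using v fin F by simp
  have sum: "degsum F = degsum ?S + 2 * dg F v" by (rule degsum_remove[OF fin v(1)])
  have le6: "degsum ?S \<le> 6" using degsum_le[of ?S] c3 fin by simp
  show ?thesis
  proof (cases "dg F v \<le> 1")
    case True then show ?thesis using sum le6 by linarith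
  next
    case False
    then have "card (nbs F v) = 2" using v by linarith
    then obtain a b where ab: "nbs F v = {a, b}" "a \<noteq> b" by (auto simp: card_2_iff)
    have vab: "v \<noteq> a" "v \<noteq> b" "a \<in> F" "b \<in> F" "v \<sim> a" "v \<sim> b"
      using ab adj_irrefl by (auto simp: nbs_def)
    have "card (?S - {a, b}) = 1" using c3 vab ab by (simp add: card_Diff_subset)
    then obtain c where c: "?S - {a, b} = {c}" by (auto simp: card_1_singleton_iff)
    then have cS: "c \<in> ?S" "c \<noteq> a" "c \<noteq> b" "?S = {a, b, c}" using vab by auto
    have "\<not> (a \<sim> c \<and> b \<sim> c)"
      using free(3) has_C4I[of v a c b F] vab cS ab v adj_commute by auto
    then have "nbs ?S c \<subseteq> {a} \<or> nbs ?S c \<subseteq> {b}"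
      using cS adj_irrefl adj_commute by (auto simp: nbs_def)
    then have dc: "dg ?S c \<le> 1" using card_mono[of "{a}" "nbs ?S c"] card_mono[of "{b}" "nbs ?S c"] by auto
    have "?S - {c} = {a, b}" using cS by auto
    then have "card (?S - {c}) = 2" using ab by simp
    then have "degsum (?S - {c}) \<le> 2" using degsum_le[of "?S - {c}"] fin by simp
    then have "degsum ?S \<le> 4" using degsum_remove[of ?S c] cS fin dc by simp
    then show ?thesis using sum v by linarith
  qed
qed

text \<open>Removing a vertex of degree at most 2 lowers the degree sum by at most 4. The bound with the
  constant 6 starts from two vertices joined by an edge. The one with 8 starts from four vertices,
  where a graph with five edges would contain a four-cycle.\<close>
lemma degsum_sparse:
  assumes "finite F" and "\<not> has_P6 F" "\<not> has_C5 F" "\<not> has_C4 F"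
  shows "(2 \<le> card F \<longrightarrow> degsum F + 6 \<le> 4 * card F) \<and> (4 \<le> card F \<longrightarrow> degsum F + 8 \<le> 4 * card F)"
  using assms
proof (induction "card F" arbitrary: F rule: less_induct)
  case less
  show ?case
  proof (cases "card F \<le> 2")
    case True
    then show ?thesis using degsum_le[OF less.prems(1)]
      by (auto dest: le_antisym)
  next
    case False
    then have "F \<noteq> {}" by auto
    then obtain v where v: "v \<in> F" "dg F v \<le> 2"
      using exists_degree_le_2 less.prems by blast
    have c: "card (F - {v}) = card F - 1" using v less.prems by simp
    have IH: "(2 \<le> card (F - {v}) \<longrightarrow> degsum (F - {v}) + 6 \<le> 4 * card (F - {v})) \<and>
        (4 \<le> card (F - {v}) \<longrightarrow> degsum (F - {v}) + 8 \<le> 4 * card (F - {v}))"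
      using less.prems has_mono[of "F - {v}" F] c False by (intro less.hyps) auto
    show ?thesis
    proof (cases "card F = 4")
      case True
      then show ?thesis using degsum_four_le less.prems by force
    next
      case False
      with IH \<open>\<not> card F \<le> 2\<close> c v degsum_remove[OF less.prems(1) v(1)] show ?thesis by auto
    qed
  qed
qed

definition K3_join :: bool where
  "K3_join \<longleftrightarrow> (\<exists>a b c. {a, b, c} \<subseteq> V \<and> distinct [a, b, c] \<and> a \<sim> b \<and> b \<sim> c \<and> a \<sim> c \<and>
     (\<forall>v\<in>V - {a, b, c}. nbs V v = {a, b, c}))"

end

section \<open>The eigenvalue equation around a vertex with the largest entry\<close>

text \<open>The setting of the core argument: \<open>x\<close> is a nonnegative eigenvector for \<open>l\<close>, scaled so that its
  largest entry, attained at \<open>u\<close>, is 1.\<close>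
locale eigen_star = simple_graph +
  fixes u :: 'a and x :: "'a \<Rightarrow> real" and l :: real
  assumes no_C6T: "\<not> has_C6T"
    and u_in: "u \<in> V" and xu: "x u = 1"
    and x_nonneg: "v \<in> V \<Longrightarrow> 0 \<le> x v" and x_le1: "v \<in> V \<Longrightarrow> x v \<le> 1"
    and eig: "v \<in> V \<Longrightarrow> (\<Sum>w\<in>nbs V v. x w) = l * x v"
    and l_ge7: "7 \<le> l"
    and no_isolated: "v \<in> V \<Longrightarrow> nbs V v \<noteq> {}"
begin

definition A :: "'a set" where "A = nbs V u"
definition B :: "'a set" where "B = V - insert u A"

lemma A_V: "A \<subseteq> V" and B_V: "B \<subseteq> V" and fin_A: "finite A" and fin_B: "finite B"
  and u_A: "u \<notin> A" and u_B: "u \<notin> B" and AB: "A \<inter> B = {}" and V_split: "V = insert u (A \<union> B)"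
proof -
  show "A \<subseteq> V" "B \<subseteq> V" by (auto simp: A_def B_def nbs_def)
  then show "finite A" "finite B" using finite_V finite_subset by blast+
  show "u \<notin> A" "u \<notin> B" "A \<inter> B = {}" "V = insert u (A \<union> B)"
    using adj_irrefl u_in by (auto simp: A_def B_def nbs_def)
qed

lemma in_V_iff: "w \<in> V \<longleftrightarrow> w = u \<or> w \<in> A \<or> w \<in> B"
  using V_split by blast

lemma adj_u_iff: "u \<sim> v \<longleftrightarrow> v \<in> A"
  using adj_V adj_sym unfolding A_def nbs_def by blast

lemma adj_u_iff': "v \<sim> u \<longleftrightarrow> v \<in> A"
  using adj_u_iff adj_commute by blast

lemma nbs_V: assumes "v \<in> A" shows "nbs V v = insert u (nbs A v \<union> nbs B v)"
  using assms by (auto simp: nbs_def in_V_iff adj_u_iff')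

lemma nbs_V_B: assumes "v \<in> B" shows "nbs V v = nbs A v \<union> nbs B v"
proof -
  have "v \<notin> A" using assms AB by blast
  then have "\<not> v \<sim> u" using adj_u_iff' by blast
  then show ?thesis by (auto simp: nbs_def in_V_iff)
qed

lemma sum_A: "sum x A = l"
  using eig[OF u_in] xu unfolding A_def by simp

lemma eig_A:
  assumes "v \<in> A"
  shows "l * x v = 1 + sum x (nbs A v) + sum x (nbs B v)"
proof -
  have "sum x (nbs V v) = x u + sum x (nbs A v \<union> nbs B v)"
    unfolding nbs_V[OF assms] using fin_A fin_B u_A u_B finite_nbs
    by (intro sum.insert) (auto simp: nbs_def)
  also have "sum x (nbs A v \<union> nbs B v) = sum x (nbs A v) + sum x (nbs B v)"
    using fin_A fin_B AB finite_nbs by (intro sum.union_disjoint) (auto simp: nbs_def)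
  finally show ?thesis using eig assms A_V xu by auto
qed

lemma eig_B:
  assumes "v \<in> B"
  shows "l * x v = sum x (nbs A v) + sum x (nbs B v)"
proof -
  have "sum x (nbs A v \<union> nbs B v) = sum x (nbs A v) + sum x (nbs B v)"
    using fin_A fin_B AB finite_nbs by (intro sum.union_disjoint) (auto simp: nbs_def)
  then show ?thesis using eig[of v] assms B_V nbs_V_B[OF assms] by auto
qed

lemma sum_x_nonneg: "S \<subseteq> V \<Longrightarrow> 0 \<le> sum x S"
  using x_nonneg by (intro sum_nonneg) auto

lemma sum_x_le_card: "S \<subseteq> V \<Longrightarrow> sum x S \<le> card S"
  using sum_bounded_above[of S x 1] x_le1 by auto

lemma nbs_sub: "nbs S v \<subseteq> S" by (auto simp: nbs_def)

text \<open>The graph may be disconnected and \<open>x\<close> may vanish far from \<open>u\<close>, but a neighbour of \<open>u\<close> receives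
  at least \<open>x u / l\<close>.\<close>
lemma x_pos: assumes "v \<in> A" shows "0 < x v"
proof -
  have "0 \<le> sum x (nbs A v)" "0 \<le> sum x (nbs B v)"
    using A_V B_V nbs_sub by (intro sum_x_nonneg; blast)+
  then have "0 < l * x v" using eig_A[OF assms] by linarith
  then show ?thesis using l_ge7 by (simp add: zero_less_mult_iff)
qed

text \<open>Joining \<open>u\<close> to the path \<open>a b c d e f\<close> gives the hexagon \<open>u b c d e f\<close> with apex \<open>a\<close> on \<open>ub\<close>.\<close>
lemma no_P6_A: "\<not> has_P6 A"
proof
  assume "has_P6 A"
  then obtain a b c d e f where p: "{a, b, c, d, e, f} \<subseteq> A" "distinct [a, b, c, d, e, f]"
     "a \<sim> b" "b \<sim> c" "c \<sim> d" "d \<sim> e" "e \<sim> f" by (rule has_P6E)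
  then have "has_C6T"
    by (intro has_C6TI[of u b c d e f a]) (use u_A in \<open>auto simp: adj_u_iff adj_u_iff'\<close>)
  with no_C6T show False ..
qed

text \<open>The contribution of a vertex of \<open>A\<close> to \<open>l\<^sup>2 - 2 * l\<close> minus the number of edges; the edges at
  \<open>u\<close> cancel against the walks that return to \<open>u\<close>. Each edge inside \<open>A\<close> is
  shared equally by its two ends. In \<open>excess\<close> an edge to \<open>B\<close> is charged in addition: it contributes the entry of its outer end and costs 1.\<close>
definition inner_excess :: "'a \<Rightarrow> real" where
  "inner_excess v = (real (dg A v) - 2) * x v - dg A v / 2"

definition excess :: "'a \<Rightarrow> real" where
  "excess v = inner_excess v - (\<Sum>w\<in>nbs B v. 1 - x w)"

lemma excess_le: "excess v \<le> inner_excess v"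
proof -
  have "0 \<le> (\<Sum>w\<in>nbs B v. 1 - x w)"
    using x_le1 B_V by (intro sum_nonneg) (auto simp: nbs_def)
  then show ?thesis unfolding excess_def by linarith
qed

text \<open>The next three bounds cover the sign changes of \<open>d - 2\<close>: a vertex of degree at least 2 inside
  \<open>A\<close> is worst at entry 1, and smaller degrees make a positive entry a loss.\<close>
lemma inner_excess_big: assumes "v \<in> A" "2 \<le> dg A v" shows "inner_excess v \<le> dg A v / 2 - 2"
proof -
  have "(real (dg A v) - 2) * x v \<le> (real (dg A v) - 2) * 1"
    using assms A_V x_le1 by (intro mult_left_mono) auto
  then show ?thesis unfolding inner_excess_def by simp
qed

lemma inner_excess_le2: assumes "v \<in> A" "dg A v \<le> 2" shows "inner_excess v \<le> - (dg A v / 2)"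
proof -
  have "(real (dg A v) - 2) * x v \<le> 0"
    using assms A_V x_nonneg by (intro mult_nonpos_nonneg) auto
  then show ?thesis unfolding inner_excess_def by simp
qed

lemma inner_excess_le1: assumes "v \<in> A" "dg A v \<le> 1" shows "inner_excess v \<le> - x v - dg A v / 2"
proof -
  have "(real (dg A v) - 2) * x v \<le> (-1) * x v"
    using assms A_V x_nonneg by (intro mult_right_mono) auto
  then show ?thesis unfolding inner_excess_def by simp
qed

text \<open>Apply the eigenvalue equation twice at \<open>u\<close>: a walk of length two from \<open>u\<close> returns to \<open>u\<close>, ends
  in \<open>A\<close>, or ends in \<open>B\<close>.\<close>
lemma l_square: "l^2 - 2 * l = card A + (\<Sum>v\<in>A. (real (dg A v) - 2) * x v) + (\<Sum>v\<in>A. sum x (nbs B v))"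
proof -
  have "(\<Sum>v\<in>A. sum x (nbs A v)) = (\<Sum>v\<in>A. \<Sum>w\<in>A. if v \<sim> w then x w else 0)"
    using fin_A by (simp add: nbs_def sum.If_cases Int_def)
  also have "\<dots> = (\<Sum>w\<in>A. \<Sum>v\<in>A. if v \<sim> w then x w else 0)" by (rule sum.swap)
  also have "\<dots> = (\<Sum>w\<in>A. dg A w * x w)"
    using fin_A by (simp add: nbs_def sum.If_cases Int_def adj_commute)
  finally have sw: "(\<Sum>v\<in>A. sum x (nbs A v)) = (\<Sum>w\<in>A. dg A w * x w)" .
  have "l^2 = (\<Sum>v\<in>A. l * x v)" using sum_A by (simp add: power2_eq_square flip: sum_distrib_left)
  also have "\<dots> = (\<Sum>v\<in>A. 1 + sum x (nbs A v) + sum x (nbs B v))" by (simp add: eig_A)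
  also have "\<dots> = card A + (\<Sum>w\<in>A. dg A w * x w) + (\<Sum>v\<in>A. sum x (nbs B v))"
    by (simp add: sum.distrib sw)
  finally have 1: "l^2 = card A + (\<Sum>w\<in>A. dg A w * x w) + (\<Sum>v\<in>A. sum x (nbs B v))" .
  have "2 * l = (\<Sum>v\<in>A. 2 * x v)" using sum_A by (simp flip: sum_distrib_left)
  with 1 show ?thesis by (simp add: left_diff_distrib sum_subtractf)
qed

lemma degsum_V: "degsum V = 2 * card A + degsum A + 2 * (\<Sum>v\<in>A. dg B v) + degsum B"
proof -
  have 1: "degsum (A \<union> B) = degsum A + 2 * (\<Sum>v\<in>A. dg B v) + degsum B"
    by (rule degsum_Un[OF fin_A fin_B AB])
  have "degsum V = degsum (V - {u}) + 2 * dg V u" by (rule degsum_remove[OF finite_V u_in])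
  moreover have "V - {u} = A \<union> B" using V_split u_A u_B by auto
  ultimately show ?thesis using 1 A_def by simp
qed

text \<open>This identity carries the proof: as \<open>degsum V / 2\<close> is the number of edges, a large \<open>l\<close> forces a
  total excess of at least \<open>-3\<close> plus the number of edges inside \<open>B\<close>.\<close>
lemma sum_excess: "sum excess A = l^2 - 2 * l - degsum V / 2 + degsum B / 2"
proof -
  have "sum excess A = (\<Sum>v\<in>A. (real (dg A v) - 2) * x v) - (\<Sum>v\<in>A. real (dg A v)) / 2
     - (\<Sum>v\<in>A. real (dg B v)) + (\<Sum>v\<in>A. sum x (nbs B v))"
    unfolding excess_def inner_excess_def by (simp add: sum_subtractf sum.distrib sum_divide_distrib)
  moreover have "(\<Sum>v\<in>A. real (dg A v)) = real (degsum A)" by (simp add: degsum_def)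
  moreover have "real (degsum V) = 2 * real (card A) + real (degsum A) + 2 * (\<Sum>v\<in>A. real (dg B v)) + real (degsum B)"
    unfolding degsum_V by simp
  ultimately show ?thesis using l_square by argo
qed

section \<open>Connected components of the neighbourhood\<close>

text \<open>Components are taken to be the minimal nonempty unions of connected components. Minimality is
  the form in which connectedness is used below: every proper part has an edge leaving it.\<close>
definition closed_in_A :: "'a set \<Rightarrow> bool" where
  "closed_in_A H \<longleftrightarrow> H \<subseteq> A \<and> (\<forall>a\<in>H. nbs A a \<subseteq> H)"

definition component :: "'a set \<Rightarrow> bool" where
  "component H \<longleftrightarrow> closed_in_A H \<and> H \<noteq> {} \<and> (\<forall>Z\<subseteq>H. Z \<noteq> {} \<longrightarrow> closed_in_A Z \<longrightarrow> Z = H)"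

text \<open>Split off a minimal nonempty closed subset. By symmetry of adjacency the rest is closed again.\<close>
lemma closed_partition:
  assumes "closed_in_A F"
  shows "\<exists>P. finite P \<and> disjoint P \<and> \<Union>P = F \<and> (\<forall>H\<in>P. component H)"
proof -
  have "finite F" using assms fin_A finite_subset unfolding closed_in_A_def by blast
  then show ?thesis using assms
  proof (induction F rule: finite_psubset_induct)
    case (psubset F)
    show ?case
    proof (cases "F = {}")
      case True then show ?thesis by (intro exI[of _ "{}"]) auto
    next
      case False
      let ?Q = "{H. H \<subseteq> F \<and> H \<noteq> {} \<and> closed_in_A H}"
      have "finite ?Q" using psubset.hyps by simp
      moreover have "F \<in> ?Q" using False psubset.prems by blast
      ultimately have "\<exists>H\<in>?Q. \<forall>Z\<in>?Q. Z \<subseteq> H \<longrightarrow> H = Z"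
        by (intro finite_has_minimal) auto
      then obtain H where Q: "H \<in> ?Q" and min: "\<forall>Z\<in>?Q. Z \<subseteq> H \<longrightarrow> H = Z" ..
      from Q have H: "H \<subseteq> F" "H \<noteq> {}" "closed_in_A H" by simp_all
      have "Z = H" if "Z \<subseteq> H" "Z \<noteq> {}" "closed_in_A Z" for Z
        using min that H(1) by blast
      then have comp: "component H" using H unfolding component_def by blast
      have cl: "closed_in_A (F - H)"
      proof -
        have "nbs A v \<subseteq> F - H" if v: "v \<in> F - H" for v
        proof
          fix w assume w: "w \<in> nbs A v"
          then have "w \<in> F" using v psubset.prems unfolding closed_in_A_def by blast
          moreover have "w \<notin> H"
          proof
            assume "w \<in> H"
            moreover have "v \<in> nbs A w"
              using w v psubset.prems adj_sym unfolding closed_in_A_def nbs_def by blast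
            ultimately show False using H(3) v unfolding closed_in_A_def by blast
          qed
          ultimately show "w \<in> F - H" by blast
        qed
        then show ?thesis using psubset.prems unfolding closed_in_A_def by blast
      qed
      have "F - H \<subset> F" using H by blast
      from psubset.IH[OF this cl]
      obtain P where P: "finite P" "disjoint P" "\<Union>P = F - H" "\<forall>H\<in>P. component H"
        by (elim exE conjE)
      have "disjoint (insert H P)"
      proof -
        have "disjnt H Y \<and> disjnt Y H" if "Y \<in> P" for Y using that P(3) unfolding disjnt_def by blast
        then show ?thesis using P(2) by (simp add: pairwise_insert)
      qed
      moreover have "\<Union>(insert H P) = F" using P(3) H(1) by auto
      moreover have "finite (insert H P)" "\<forall>Y\<in>insert H P. component Y" using P(1,4) comp by simp_all
      ultimately show ?thesis by blast
    qed
  qed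
qed

lemma component_A: "component H \<Longrightarrow> H \<subseteq> A"
  unfolding component_def closed_in_A_def by blast

lemma component_fin: "component H \<Longrightarrow> finite H"
  using component_A fin_A finite_subset by blast

lemma component_nbs: "\<lbrakk>component H; v \<in> H\<rbrakk> \<Longrightarrow> nbs A v = nbs H v"
  unfolding component_def closed_in_A_def nbs_def by blast

lemma component_edge:
  assumes "component H" "Z \<subseteq> H" "Z \<noteq> {}" "Z \<noteq> H"
  obtains y z where "y \<in> Z" "z \<in> H" "z \<notin> Z" "y \<sim> z"
proof -
  have "\<not> closed_in_A Z" using assms unfolding component_def by blast
  moreover have "Z \<subseteq> A" using assms component_A by blast
  ultimately obtain y z where yz: "y \<in> Z" "z \<in> nbs A y" "z \<notin> Z" unfolding closed_in_A_def by blast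
  then have "z \<in> nbs H y" using component_nbs[OF assms(1)] assms(2) by blast
  then show ?thesis using yz that by (auto simp: nbs_def)
qed

text \<open>The edge \<open>ac\<close> joined to an independent set, which is what \<open>A\<close> looks like in the extremal graph.\<close>
definition K2_join :: "'a set \<Rightarrow> bool" where
  "K2_join H \<longleftrightarrow> (\<exists>a\<in>H. \<exists>c\<in>H. a \<sim> c \<and> (\<forall>v\<in>H - {a, c}. nbs H v = {a, c}))"

text \<open>What is needed of each component in the final summation. The first alternative is that of
  single vertices and stars. Two components of the second kind already have total excess at most
  \<open>-4\<close>. If there is only one, the other components contribute at most \<open>sum x H - l\<close>, which
  explains the inner alternatives: the first yields a total of at most \<open>3 - l \<le> -4\<close>, and only the
  last one leaves room for equality.\<close>
definition within_budget :: "'a set \<Rightarrow> bool" where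
  "within_budget H \<longleftrightarrow> sum excess H \<le> - sum x H \<or>
     (sum excess H \<le> -2 \<and> (sum excess H + sum x H \<le> 3 \<or> sum excess H < -3 \<or> (sum inner_excess H \<le> -3 \<and> K2_join H)))"

text \<open>Complete on five vertices, up to at most one missing edge.\<close>
definition near_K5 :: "'a set \<Rightarrow> bool" where
  "near_K5 H \<longleftrightarrow> card H = 5 \<and> 18 \<le> degsum H"

lemma sum_excess_le_inner_excess: "sum excess H \<le> sum inner_excess H"
  by (intro sum_mono excess_le)


section \<open>Components that contain a five-cycle\<close>

text \<open>A sixth vertex would be adjacent to the cycle somewhere and, followed by the cycle, give a path
  on six vertices.\<close>
lemma C5_case:
  assumes H: "component H" and C5: "has_C5 H"
  shows "within_budget H \<or> near_K5 H"
proof -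
  obtain a b c d e where p: "{a, b, c, d, e} \<subseteq> H" "distinct [a, b, c, d, e]"
     "a \<sim> b" "b \<sim> c" "c \<sim> d" "d \<sim> e" "e \<sim> a" using C5 by (rule has_C5E)
  have H5: "H = {a, b, c, d, e}"
  proof (rule ccontr)
    assume "H \<noteq> {a, b, c, d, e}"
    then obtain y z where yz: "y \<in> {a, b, c, d, e}" "z \<in> H" "z \<notin> {a, b, c, d, e}" "y \<sim> z"
      using component_edge[OF H p(1)] by blast
    have "has_P6 H"
      using yz(1)
    proof (elim insertE)
      assume "y = a"
      then show ?thesis by (intro has_P6I[of z a b c d e]) (use yz p in \<open>auto simp: adj_commute\<close>)
    next
      assume "y = b"
      then show ?thesis by (intro has_P6I[of z b c d e a]) (use yz p in \<open>auto simp: adj_commute\<close>)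
    next
      assume "y = c"
      then show ?thesis by (intro has_P6I[of z c d e a b]) (use yz p in \<open>auto simp: adj_commute\<close>)
    next
      assume "y = d"
      then show ?thesis by (intro has_P6I[of z d e a b c]) (use yz p in \<open>auto simp: adj_commute\<close>)
    next
      assume "y = e"
      then show ?thesis by (intro has_P6I[of z e a b c d]) (use yz p in \<open>auto simp: adj_commute\<close>)
    qed simp
    then show False using no_P6_A has_mono(1) component_A[OF H] by blast
  qed
  have c5: "card H = 5" using H5 p(2) by simp
  have "2 \<le> dg H v" if v: "v \<in> H" for v
  proof -
    have rev: "b \<sim> a" "c \<sim> b" "d \<sim> c" "e \<sim> d" "a \<sim> e" using p adj_sym by blast+
    note fin = component_fin[OF H]
    show ?thesis using v[unfolded H5]
    proof (elim insertE)
      assume "v = a" then show ?thesis using p rev fin by (intro two_le_dg[of H b e]) auto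
    next
      assume "v = b" then show ?thesis using p rev fin by (intro two_le_dg[of H a c]) auto
    next
      assume "v = c" then show ?thesis using p rev fin by (intro two_le_dg[of H b d]) auto
    next
      assume "v = d" then show ?thesis using p rev fin by (intro two_le_dg[of H c e]) auto
    next
      assume "v = e" then show ?thesis using p rev fin by (intro two_le_dg[of H a d]) auto
    qed simp
  qed
  then have "inner_excess v \<le> dg H v / 2 - 2" if "v \<in> H" for v
    using inner_excess_big[of v] component_nbs[OF H that] component_A[OF H] that by auto
  then have "sum inner_excess H \<le> (\<Sum>v\<in>H. dg H v / 2 - 2)" by (rule sum_mono)
  also have "\<dots> = degsum H / 2 - 10"
    using c5 by (simp add: sum_subtractf degsum_def sum_divide_distrib)
  finally have le: "sum excess H \<le> degsum H / 2 - 10" using sum_excess_le_inner_excess[of H] by linarith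
  have x5: "sum x H \<le> 5" using sum_x_le_card[of H] component_A[OF H] A_V c5 by auto
  show ?thesis
  proof (cases "degsum H \<le> 16")
    case True
    then have "sum excess H \<le> -2" using le by linarith
    then show ?thesis using x5 unfolding within_budget_def by linarith
  next
    case False
    have "even (degsum H)" by (rule even_degsum[OF component_fin[OF H]])
    then obtain k where "degsum H = 2 * k" by (elim evenE)
    with False have "18 \<le> degsum H" by simp
    then show ?thesis using c5 unfolding near_K5_def by simp
  qed
qed

section \<open>Components that contain a four-cycle but no five-cycle\<close>

text \<open>A path of two outside vertices reaching the four-cycle would extend to a path on six vertices, so
  the outside vertices are pairwise nonadjacent and all adjacent to the cycle. A vertex adjacent to
  two consecutive vertices of the cycle, or to two opposite vertices when the other two are joined
  by a chord, would create a five-cycle. So outside vertices have degree at most 2 and their edges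
  are paid for exactly by the increase of the degrees on the cycle. Only outside vertices of
  degree at most 1 leave a further loss.\<close>
lemma C4_structure:
  assumes H: "component H" and no5: "\<not> has_C5 H"
    and p: "{a, b, c, d} \<subseteq> H" "distinct [a, b, c, d]" "a \<sim> b" "b \<sim> c" "c \<sim> d" "d \<sim> a"
    and K: "K = {a, b, c, d}"
  shows "y \<in> H - K \<Longrightarrow> nbs H y = nbs K y"
    and "y \<in> H - K \<Longrightarrow> nbs K y \<subseteq> {a, c} \<or> nbs K y \<subseteq> {b, d}"
    and "y \<in> H - K \<Longrightarrow> b \<sim> d \<Longrightarrow> \<not> {a, c} \<subseteq> nbs K y"
    and "y \<in> H - K \<Longrightarrow> a \<sim> c \<Longrightarrow> \<not> {b, d} \<subseteq> nbs K y"
    and "sum inner_excess H \<le> degsum K / 2 - 8 - (\<Sum>y\<in>H - K. if dg K y \<le> 1 then x y else 0)"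
proof -
  note fin = component_fin[OF H]
  have KH: "K \<subseteq> H" and finK: "finite K" using p K by auto
  have no6: "\<not> has_P6 H" using no_P6_A has_mono(1) component_A[OF H] by blast
  have hub: False if "k \<in> K" "y \<in> H - K" "z \<in> H - K" "y \<sim> k" "z \<sim> y" for k y z
  proof -
    have yz: "y \<noteq> z" using that adj_neq by blast
    have "has_P6 H"
      using that(1)[unfolded K]
    proof (elim insertE)
      assume "k = a"
      then show ?thesis by (intro has_P6I[of z y a b c d]) (use yz that(2-) p K in \<open>auto simp: adj_commute\<close>)
    next
      assume "k = b"
      then show ?thesis by (intro has_P6I[of z y b c d a]) (use yz that(2-) p K in \<open>auto simp: adj_commute\<close>)
    next
      assume "k = c"
      then show ?thesis by (intro has_P6I[of z y c d a b]) (use yz that(2-) p K in \<open>auto simp: adj_commute\<close>)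
    next
      assume "k = d"
      then show ?thesis by (intro has_P6I[of z y d a b c]) (use yz that(2-) p K in \<open>auto simp: adj_commute\<close>)
    qed simp
    with no6 show False ..
  qed
  have touch: "\<exists>k\<in>K. y \<sim> k" if y: "y \<in> H - K" for y
  proof (rule ccontr)
    assume no: "\<not> ?thesis"
    let ?Z = "K \<union> {y \<in> H. \<exists>k\<in>K. y \<sim> k}"
    have "y \<notin> ?Z" using y no by blast
    then have "?Z \<subseteq> H" "?Z \<noteq> {}" "?Z \<noteq> H" using KH K y by blast+
    then obtain w z where wz: "w \<in> ?Z" "z \<in> H" "z \<notin> ?Z" "w \<sim> z"
      by (rule component_edge[OF H])
    have wK: "w \<notin> K" using wz adj_sym by blast
    then obtain k where "k \<in> K" "w \<sim> k" using wz by blast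
    then show False using hub[of k w z] wz wK adj_sym by blast
  qed
  have indep: "\<not> y \<sim> z" if "y \<in> H - K" "z \<in> H - K" for y z
    using touch[of y] that hub[of _ y z] adj_sym by blast
  show nb: "nbs H y = nbs K y" if "y \<in> H - K" for y
    using indep[OF that] KH unfolding nbs_def by blast
  have no_consec: "\<not> (y \<sim> a \<and> y \<sim> b)" "\<not> (y \<sim> b \<and> y \<sim> c)" "\<not> (y \<sim> c \<and> y \<sim> d)" "\<not> (y \<sim> d \<and> y \<sim> a)"
    if y: "y \<in> H - K" for y
  proof -
    show "\<not> (y \<sim> a \<and> y \<sim> b)"
    proof
      assume "y \<sim> a \<and> y \<sim> b"
      then have "has_C5 H" by (intro has_C5I[of y a d c b]) (use y p K in \<open>auto simp: adj_commute\<close>)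
      with no5 show False ..
    qed
    show "\<not> (y \<sim> b \<and> y \<sim> c)"
    proof
      assume "y \<sim> b \<and> y \<sim> c"
      then have "has_C5 H" by (intro has_C5I[of y b a d c]) (use y p K in \<open>auto simp: adj_commute\<close>)
      with no5 show False ..
    qed
    show "\<not> (y \<sim> c \<and> y \<sim> d)"
    proof
      assume "y \<sim> c \<and> y \<sim> d"
      then have "has_C5 H" by (intro has_C5I[of y c b a d]) (use y p K in \<open>auto simp: adj_commute\<close>)
      with no5 show False ..
    qed
    show "\<not> (y \<sim> d \<and> y \<sim> a)"
    proof
      assume "y \<sim> d \<and> y \<sim> a"
      then have "has_C5 H" by (intro has_C5I[of y d c b a]) (use y p K in \<open>auto simp: adj_commute\<close>)
      with no5 show False ..
    qed
  qed
  show opp: "nbs K y \<subseteq> {a, c} \<or> nbs K y \<subseteq> {b, d}" if "y \<in> H - K" for y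
    using no_consec[OF that] unfolding nbs_def K by blast
  show "\<not> {a, c} \<subseteq> nbs K y" if y: "y \<in> H - K" and "b \<sim> d" for y
  proof
    assume "{a, c} \<subseteq> nbs K y"
    then have "y \<sim> a" "y \<sim> c" by (auto simp: nbs_def)
    then have "has_C5 H" by (intro has_C5I[of y a b d c]) (use y p K \<open>b \<sim> d\<close> in \<open>auto simp: adj_commute\<close>)
    with no5 show False ..
  qed
  show "\<not> {b, d} \<subseteq> nbs K y" if y: "y \<in> H - K" and "a \<sim> c" for y
  proof
    assume "{b, d} \<subseteq> nbs K y"
    then have "y \<sim> b" "y \<sim> d" by (auto simp: nbs_def)
    then have "has_C5 H" by (intro has_C5I[of y b a c d]) (use y p K \<open>a \<sim> c\<close> in \<open>auto simp: adj_commute\<close>)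
    with no5 show False ..
  qed
  let ?Y = "H - K"
  let ?x = "\<lambda>y. if dg K y \<le> 1 then x y else 0"
  have dK: "2 \<le> dg K k" if "k \<in> K" for k
  proof -
    have rev: "b \<sim> a" "c \<sim> b" "d \<sim> c" "a \<sim> d" using p adj_sym by blast+
    show ?thesis using that[unfolded K]
    proof (elim insertE)
      assume "k = a" then show ?thesis using p rev K finK by (intro two_le_dg[of K b d]) auto
    next
      assume "k = b" then show ?thesis using p rev K finK by (intro two_le_dg[of K a c]) auto
    next
      assume "k = c" then show ?thesis using p rev K finK by (intro two_le_dg[of K b d]) auto
    next
      assume "k = d" then show ?thesis using p rev K finK by (intro two_le_dg[of K a c]) auto
    qed simp
  qed
  have split: "dg A v = dg K v + dg ?Y v" if "v \<in> H" for v
  proof -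
    have "K \<union> ?Y = H" using KH by blast
    then show ?thesis using dg_Un[of K ?Y v] finK fin component_nbs[OF H that] by simp
  qed
  have "sum inner_excess K \<le> (\<Sum>k\<in>K. (real (dg K k) + real (dg ?Y k)) / 2 - 2)"
  proof (rule sum_mono)
    fix k assume k: "k \<in> K"
    then have kH: "k \<in> H" using KH by blast
    then have "k \<in> A" using component_A[OF H] by blast
    then show "inner_excess k \<le> (real (dg K k) + real (dg ?Y k)) / 2 - 2"
      using inner_excess_big[of k] split[OF kH] dK[OF k] by simp
  qed
  also have "\<dots> = (real (degsum K) + (\<Sum>k\<in>K. real (dg ?Y k))) / 2 - 8"
    using p(2) K by (simp add: sum_subtractf sum.distrib degsum_def flip: sum_divide_distrib)
  finally have sK: "sum inner_excess K \<le> (real (degsum K) + (\<Sum>k\<in>K. real (dg ?Y k))) / 2 - 8" .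
  have "sum inner_excess ?Y \<le> (\<Sum>y\<in>?Y. - (real (dg K y) / 2) - ?x y)"
  proof (rule sum_mono)
    fix y assume y: "y \<in> ?Y"
    then have yH: "y \<in> H" "y \<in> A" using component_A[OF H] by auto
    have d: "dg A y = dg K y" using component_nbs[OF H yH(1)] nb[OF y] by simp
    have "dg K y \<le> 2"
      using opp[OF y] card_mono[of "{a, c}" "nbs K y"] card_mono[of "{b, d}" "nbs K y"] p(2) by auto
    then show "inner_excess y \<le> - (real (dg K y) / 2) - ?x y"
      using inner_excess_le2[of y] inner_excess_le1[of y] d yH by auto
  qed
  also have "\<dots> = - (\<Sum>y\<in>?Y. real (dg K y)) / 2 - sum ?x ?Y"
    by (simp add: sum_subtractf sum_negf flip: sum_divide_distrib)
  finally have sY: "sum inner_excess ?Y \<le> - (\<Sum>y\<in>?Y. real (dg K y)) / 2 - sum ?x ?Y" .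
  have "(\<Sum>k\<in>K. dg ?Y k) = (\<Sum>y\<in>?Y. dg K y)" using double_count_edges[of K ?Y] finK fin by simp
  then have "(\<Sum>k\<in>K. real (dg ?Y k)) = (\<Sum>y\<in>?Y. real (dg K y))" by (metis of_nat_sum)
  moreover have "sum inner_excess H = sum inner_excess ?Y + sum inner_excess K" by (rule sum.subset_diff[OF KH fin])
  ultimately show "sum inner_excess H \<le> degsum K / 2 - 8 - sum ?x ?Y" using sK sY by argo
qed

text \<open>The case of the extremal graph: if the cycle has exactly one chord \<open>ac\<close>, there is no slack unless
  all outside vertices are adjacent to both \<open>a\<close> and \<open>c\<close>.\<close>
lemma C4_one_chord:
  assumes H: "component H" and no5: "\<not> has_C5 H"
    and p: "{a, b, c, d} \<subseteq> H" "distinct [a, b, c, d]" "a \<sim> b" "b \<sim> c" "c \<sim> d" "d \<sim> a"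
    and chord: "a \<sim> c" "\<not> b \<sim> d" and five: "degsum {a, b, c, d} = 10"
  shows "within_budget H"
proof -
  define K where "K = {a, b, c, d}"
  note S = C4_structure[OF H no5 p K_def]
  let ?Y = "H - K"
  let ?x = "\<lambda>y. if dg K y \<le> 1 then x y else 0"
  have KH: "K \<subseteq> H" using p K_def by auto
  have x_pos': "0 < x y" if "y \<in> ?Y" for y using that x_pos component_A[OF H] by auto
  have bound: "sum inner_excess H \<le> -3 - sum ?x ?Y" using S(5) five K_def by simp
  have nonneg: "0 \<le> sum ?x ?Y" using x_pos' by (intro sum_nonneg) (auto simp: less_imp_le)
  note le = sum_excess_le_inner_excess[of H]
  show ?thesis
  proof (cases "\<exists>y\<in>?Y. dg K y \<le> 1")
    case True
    then obtain y where y: "y \<in> ?Y" "dg K y \<le> 1" by blast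
    have "0 < sum ?x ?Y"
      by (rule sum_pos2[of _ y]) (use y x_pos' component_fin[OF H] in \<open>auto simp: less_imp_le\<close>)
    then show ?thesis using bound le unfolding within_budget_def by linarith
  next
    case False
    have Y: "nbs H y = {a, c}" if y: "y \<in> ?Y" for y
    proof -
      have two: "2 \<le> dg K y" using False y by force
      have "\<not> nbs K y \<subseteq> {b, d}"
      proof
        assume sub: "nbs K y \<subseteq> {b, d}"
        have "nbs K y = {b, d}" by (rule card_seteq[OF _ sub]) (use two p(2) in auto)
        then show False using S(4)[OF y chord(1)] by simp
      qed
      then have sub: "nbs K y \<subseteq> {a, c}" using S(2)[OF y] by blast
      have "nbs K y = {a, c}" by (rule card_seteq[OF _ sub]) (use two p(2) in auto)
      then show ?thesis using S(1)[OF y] by simp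
    qed
    have YK: "\<not> b \<sim> y" "\<not> d \<sim> y" if y: "y \<in> ?Y" for y
    proof -
      have "b \<notin> nbs H y" "d \<notin> nbs H y" using Y[OF y] p(2) by auto
      moreover have "b \<in> H" "d \<in> H" using p(1) by auto
      ultimately show "\<not> b \<sim> y" "\<not> d \<sim> y" using adj_sym unfolding nbs_def by blast+
    qed
    have nK: "nbs K b = {a, c}" "nbs K d = {a, c}"
      using p chord adj_irrefl unfolding K_def nbs_def by (auto simp: adj_commute)
    have "nbs H b = {a, c}" "nbs H d = {a, c}"
      using nK YK KH unfolding nbs_def by blast+
    then have "nbs H v = {a, c}" if "v \<in> H - {a, c}" for v
      using that Y unfolding K_def by blast
    then have "K2_join H" unfolding K2_join_def using p chord by blast
    then show ?thesis using bound nonneg le unfolding within_budget_def by linarith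
  qed
qed

text \<open>With both chords the four-cycle spans a complete graph, all outside vertices have degree at most
  1, and the bound \<open>-2\<close> is compensated by their entries. Without chords the excess is at most \<open>-4\<close>.\<close>
lemma C4_case:
  assumes H: "component H" and no5: "\<not> has_C5 H" and C4: "has_C4 H"
  shows "within_budget H"
proof -
  obtain a b c d where p: "{a, b, c, d} \<subseteq> H" "distinct [a, b, c, d]"
     "a \<sim> b" "b \<sim> c" "c \<sim> d" "d \<sim> a" using C4 by (rule has_C4E)
  define K where "K = {a, b, c, d}"
  note S = C4_structure[OF H no5 p K_def]
  let ?Y = "H - K"
  let ?x = "\<lambda>y. if dg K y \<le> 1 then x y else 0"
  have KH: "K \<subseteq> H" using p K_def by auto
  have HV: "H \<subseteq> V" using component_A[OF H] A_V by blast
  have nonneg: "0 \<le> sum ?x ?Y" using x_nonneg HV by (intro sum_nonneg) auto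
  note le = sum_excess_le_inner_excess[of H]
  have "nbs K a = (if a \<sim> c then {b, c, d} else {b, d})"
       "nbs K b = (if b \<sim> d then {a, c, d} else {a, c})"
       "nbs K c = (if a \<sim> c then {a, b, d} else {b, d})"
       "nbs K d = (if b \<sim> d then {a, b, c} else {a, c})"
    using p(2-) adj_irrefl unfolding K_def nbs_def by (auto simp: adj_commute)
  then have ds: "degsum K = 8 + (if a \<sim> c then 2 else 0) + (if b \<sim> d then 2 else 0)"
    using p(2) unfolding degsum_def by (simp add: K_def)
  consider "a \<sim> c" "b \<sim> d" | "a \<sim> c" "\<not> b \<sim> d" | "\<not> a \<sim> c" "b \<sim> d" | "\<not> a \<sim> c" "\<not> b \<sim> d" by blast
  then show ?thesis
  proof cases
    case 1
    have "dg K y \<le> 1" if y: "y \<in> ?Y" for y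
    proof (rule ccontr)
      assume "\<not> ?thesis"
      then have two: "2 \<le> dg K y" by simp
      from S(2)[OF y] show False
      proof
        assume sub: "nbs K y \<subseteq> {a, c}"
        have "nbs K y = {a, c}" by (rule card_seteq[OF _ sub]) (use two p(2) in auto)
        then show False using S(3)[OF y 1(2)] by simp
      next
        assume sub: "nbs K y \<subseteq> {b, d}"
        have "nbs K y = {b, d}" by (rule card_seteq[OF _ sub]) (use two p(2) in auto)
        then show False using S(4)[OF y 1(1)] by simp
      qed
    qed
    then have "sum ?x ?Y = sum x ?Y" by (intro sum.cong) auto
    then have b: "sum inner_excess H \<le> -2 - sum x ?Y" using S(5) ds 1 by simp
    have "sum x H = sum x ?Y + sum x K" by (rule sum.subset_diff[OF KH component_fin[OF H]])
    moreover have "card K = 4" using p(2) by (simp add: K_def)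
    then have "sum x K \<le> 4" using sum_x_le_card[of K] KH HV by auto
    moreover have "0 \<le> sum x ?Y" using HV by (intro sum_x_nonneg) auto
    ultimately show ?thesis using b le unfolding within_budget_def by linarith
  next
    case 2
    then show ?thesis using C4_one_chord[OF H no5 p] ds K_def by simp
  next
    case 3
    have "{b, c, d, a} = K" unfolding K_def by blast
    then have ten: "degsum {b, c, d, a} = 10" using 3 ds by simp
    show ?thesis
      by (rule C4_one_chord[OF H no5 _ _ p(4,5,6,3) 3(2) _ ten])
        (use p 3(1) in \<open>auto simp: adj_commute\<close>)
  next
    case 4
    then have "sum inner_excess H \<le> -4 - sum ?x ?Y" using S(5) ds by simp
    then show ?thesis using nonneg le unfolding within_budget_def by linarith
  qed
qed

section \<open>Components without cycles of length four or five\<close>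

text \<open>Let \<open>C\<close> be the set of vertices of degree at least 2. Each remaining vertex costs its entry and
  has at most one edge to \<open>C\<close>, the gain of which is cancelled by the half edges counted at
  both of its ends. What is left is the edge count of \<open>C\<close> minus \<open>2 * card C\<close>, which
  \<open>degsum_sparse\<close> bounds by \<open>-3\<close>, or by \<open>-4\<close> if \<open>C\<close> has at least four vertices. A set \<open>C\<close>
  with at most one vertex occurs in stars only, where the centre gains less than its edges cost.\<close>
lemma sparse_case:
  assumes H: "component H" and free: "\<not> has_C5 H" "\<not> has_C4 H"
  shows "within_budget H"
proof -
  note fin = component_fin[OF H] and HA = component_A[OF H]
  have no6: "\<not> has_P6 H" using no_P6_A has_mono(1) HA by blast
  define C where "C = {v \<in> H. 2 \<le> dg H v}"
  define L where "L = H - C"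
  have CH: "C \<subseteq> H" and finC: "finite C" and finL: "finite L" and CL: "C \<inter> L = {}" "H = C \<union> L"
    using fin by (auto simp: C_def L_def)
  have HV: "H \<subseteq> V" using HA A_V by blast
  have dA: "dg A v = dg H v" if "v \<in> H" for v using component_nbs[OF H that] by simp
  have dH: "dg H v = dg C v + dg L v" for v using dg_Un[OF finC finL CL(1)] CL(2) by simp
  have split: "sum f H = sum f C + sum f L" for f :: "'a \<Rightarrow> real"
    unfolding CL(2) by (rule sum.union_disjoint[OF finC finL CL(1)])
  have cross: "(\<Sum>v\<in>C. real (dg L v)) = (\<Sum>v\<in>L. real (dg C v))"
    using double_count_edges[OF finC finL] by (metis of_nat_sum)
  have "sum inner_excess L \<le> (\<Sum>v\<in>L. - x v - real (dg C v) / 2)"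
  proof (rule sum_mono)
    fix v assume v: "v \<in> L"
    then have "v \<in> A" "v \<in> H" "dg H v \<le> 1" using HA by (auto simp: L_def C_def)
    then have "inner_excess v \<le> - x v - real (dg A v) / 2" "dg C v \<le> dg A v"
      using inner_excess_le1[of v] dA[of v] dH[of v] by simp_all
    then show "inner_excess v \<le> - x v - real (dg C v) / 2" by linarith
  qed
  also have "\<dots> = - sum x L - (\<Sum>v\<in>L. real (dg C v)) / 2"
    by (simp add: sum_subtractf sum_negf flip: sum_divide_distrib)
  finally have sL: "sum inner_excess L \<le> - sum x L - (\<Sum>v\<in>L. real (dg C v)) / 2" .
  have xL: "0 \<le> sum x L" using HV CL by (intro sum_x_nonneg) auto
  note le = sum_excess_le_inner_excess[of H]
  consider "card C = 0" | "card C = 1" | "2 \<le> card C" by linarith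
  then show ?thesis
  proof cases
    case 1
    then have "C = {}" using finC by simp
    then show ?thesis using sL split[of inner_excess] split[of x] le unfolding within_budget_def by (simp add: nbs_def)
  next
    case 2
    then obtain v where v: "C = {v}" by (auto simp: card_1_singleton_iff)
    have vH: "v \<in> H" "2 \<le> dg H v" "v \<in> A" using v HA by (auto simp: C_def)
    have "nbs C v = {}" using v adj_irrefl by (auto simp: nbs_def)
    then have dL: "dg L v = dg H v" using dH[of v] by simp
    have "sum inner_excess H \<le> (real (dg H v) - 2) * x v - dg H v / 2 - sum x L - dg H v / 2"
      using sL cross split[of inner_excess] v dL dA[OF vH(1)] by (simp add: inner_excess_def)
    moreover have "(real (dg H v) - 1) * x v \<le> (real (dg H v) - 1) * 1"
      using vH x_le1 A_V by (intro mult_left_mono) auto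
    moreover have "sum x H = x v + sum x L" using split[of x] v by simp
    ultimately have "sum inner_excess H \<le> - sum x H" by (simp add: algebra_simps)
    then show ?thesis using le unfolding within_budget_def by linarith
  next
    case 3
    have "sum inner_excess C \<le> (\<Sum>v\<in>C. (real (dg C v) + real (dg L v)) / 2 - 2)"
    proof (rule sum_mono)
      fix v assume v: "v \<in> C"
      then have "v \<in> A" "v \<in> H" "2 \<le> dg H v" using HA by (auto simp: C_def)
      then show "inner_excess v \<le> (real (dg C v) + real (dg L v)) / 2 - 2"
        using inner_excess_big[of v] dA[of v] dH[of v] by simp
    qed
    also have "\<dots> = (real (degsum C) + (\<Sum>v\<in>C. real (dg L v))) / 2 - 2 * card C"
      by (simp add: sum_subtractf sum.distrib degsum_def flip: sum_divide_distrib)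
    finally have tot: "sum inner_excess H \<le> real (degsum C) / 2 - 2 * card C - sum x L"
      using sL cross split[of inner_excess] by (simp add: add_divide_distrib)
    have sparse: "(2 \<le> card C \<longrightarrow> degsum C + 6 \<le> 4 * card C) \<and> (4 \<le> card C \<longrightarrow> degsum C + 8 \<le> 4 * card C)"
      using degsum_sparse[OF finC] no6 free has_mono[OF CH] by blast
    show ?thesis
    proof (cases "4 \<le> card C")
      case True
      then have "real (degsum C) + 8 \<le> 4 * real (card C)" using sparse by linarith
      then show ?thesis using tot xL le unfolding within_budget_def by linarith
    next
      case False
      have "real (degsum C) + 6 \<le> 4 * real (card C)" using sparse 3 by linarith
      moreover have "C \<subseteq> V" using CH HV by blast
      then have "sum x C \<le> 3" using sum_x_le_card[of C] False by linarith
      ultimately show ?thesis using tot xL le split[of x] unfolding within_budget_def by linarith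
    qed
  qed
qed


lemma component_within_budget_or_near_K5:
  assumes H: "component H"
  shows "within_budget H \<or> near_K5 H"
  using C5_case[OF H] C4_case[OF H] sparse_case[OF H] by blast

section \<open>Components with at least nine edges on five vertices\<close>

text \<open>A missing edge accounts for two missing ordered pairs, and at most two of the twenty are missing.\<close>
lemma near_K5_missing:
  assumes H: "component H" and D: "near_K5 H"
    and xy: "a \<in> H" "b \<in> H" "a \<noteq> b" "\<not> a \<sim> b"
    and pq: "p \<in> H" "q \<in> H" "p \<noteq> q" "{p, q} \<noteq> {a, b}"
  shows "p \<sim> q"
proof (rule ccontr)
  assume npq: "\<not> p \<sim> q"
  note fin = component_fin[OF H]
  define N where "N = (\<lambda>v. {w \<in> H - {v}. \<not> v \<sim> w})"
  define M where "M = (SIGMA v:H. N v)"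
  have finN: "finite (N v)" for v using fin by (simp add: N_def)
  have c5: "card H = 5" "18 \<le> degsum H" using D by (auto simp: near_K5_def)
  have four: "dg H v + card (N v) = 4" if v: "v \<in> H" for v
  proof -
    have "nbs H v \<union> N v = H - {v}" "nbs H v \<inter> N v = {}"
      using adj_irrefl by (auto simp: nbs_def N_def)
    then have "card (H - {v}) = dg H v + card (N v)"
      using card_Un_disjoint[of "nbs H v" "N v"] finite_nbs[OF fin] finN by simp
    then show ?thesis using c5 v by simp
  qed
  have "degsum H + card M = (\<Sum>v\<in>H. dg H v + card (N v))"
    unfolding degsum_def M_def using fin finN by (simp add: sum.distrib)
  also have "\<dots> = (\<Sum>v\<in>H. 4)" by (rule sum.cong) (simp_all add: four)
  finally have "card M \<le> 2" using c5 by simp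
  moreover have "finite M" unfolding M_def using fin finN by simp
  moreover have "insert (p, q) {(a, b), (b, a)} \<subseteq> M"
    using xy pq npq adj_sym unfolding M_def N_def by auto
  ultimately have "card (insert (p, q) {(a, b), (b, a)}) \<le> 2"
    using card_mono le_trans by blast
  moreover have "(p, q) \<notin> {(a, b), (b, a)}" using pq(4) by (auto simp: doubleton_eq_iff)
  then have "card (insert (p, q) {(a, b), (b, a)}) = Suc (card {(a, b), (b, a)})"
    by (intro card_insert_disjoint) simp_all
  moreover have "card {(a, b), (b, a)} = 2" using xy(3) by (subst card_2_iff) blast
  ultimately show False by linarith
qed

lemma three_others:
  assumes "card H = 5" "v \<in> H" "v' \<in> H" "v \<noteq> v'"
  obtains p q r where "H = {v, v', p, q, r}" "distinct [v, v', p, q, r]"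
proof -
  have fin: "finite H" using assms(1) by (metis card.infinite zero_neq_numeral)
  have "card (H - {v, v'}) = 3" using assms fin by (simp add: card_Diff_subset)
  then obtain p q r where "H - {v, v'} = {p, q, r}" "distinct [p, q, r]" by (auto simp: card_3_iff)
  moreover from this have "{p, q, r} \<inter> {v, v'} = {}" by blast
  ultimately show ?thesis using that[of p q r] assms by auto
qed

text \<open>Starting from an arbitrary path on four vertices, if one of its edges is the missing one, a
  rearrangement avoids it.\<close>
lemma near_K5_path:
  assumes H: "component H" and D: "near_K5 H" and v: "v \<in> H"
  obtains c b t where "{c, b, t} \<subseteq> H" "distinct [v, c, b, t]" "v \<sim> c" "c \<sim> b" "b \<sim> t"
proof -
  have c5: "card H = 5" using D by (simp add: near_K5_def)
  then have "card (H - {v}) = 4" using v component_fin[OF H] by simp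
  then have "H - {v} \<noteq> {}" by (metis card.empty zero_neq_numeral)
  then obtain p where p: "p \<in> H - {v}" by blast
  then obtain q r s where l: "H = {v, p, q, r, s}" "distinct [v, p, q, r, s]"
    using three_others[OF c5 v, of p] by blast
  note miss = near_K5_missing[OF H D]
  have mem: "p \<in> H" "q \<in> H" "r \<in> H" "s \<in> H" using l(1) by auto
  consider "\<not> v \<sim> p" | "\<not> p \<sim> q" | "\<not> q \<sim> r" | "v \<sim> p" "p \<sim> q" "q \<sim> r" by blast
  then show ?thesis
  proof cases
    case 1
    have "v \<sim> q" "q \<sim> p" "p \<sim> r"
      by (rule miss[of v p]; use 1 l(2) mem v in \<open>auto simp: doubleton_eq_iff\<close>)+
    then show ?thesis using that[of q p r] mem l(2) by auto
  next
    case 2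
    have "v \<sim> p" "p \<sim> r" "r \<sim> q"
      by (rule miss[of p q]; use 2 l(2) mem v in \<open>auto simp: doubleton_eq_iff\<close>)+
    then show ?thesis using that[of p r q] mem l(2) by auto
  next
    case 3
    have "v \<sim> p" "p \<sim> q" "q \<sim> s"
      by (rule miss[of q r]; use 3 l(2) mem v in \<open>auto simp: doubleton_eq_iff\<close>)+
    then show ?thesis using that[of p q s] mem l(2) by auto
  next
    case 4
    then show ?thesis using that[of p q r] mem l(2) by auto
  qed
qed

text \<open>A path \<open>v w a\<close> that leaves the component through \<open>B\<close> and returns to \<open>u\<close> closes up, along a path
  \<open>v c b\<close> inside the component, to the hexagon \<open>u b c v w a\<close>, with an apex on \<open>ub\<close>.\<close>
lemma near_K5_no_exit:
  assumes H: "component H" and D: "near_K5 H" and v: "v \<in> H"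
    and w: "w \<in> B" "w \<sim> v" and a: "a \<in> A" "w \<sim> a"
  shows "a \<in> H"
proof (rule ccontr)
  assume aH: "a \<notin> H"
  obtain c b t where p: "{c, b, t} \<subseteq> H" "distinct [v, c, b, t]" "v \<sim> c" "c \<sim> b" "b \<sim> t"
    by (rule near_K5_path[OF H D v])
  have mem: "c \<in> A" "b \<in> A" "t \<in> A" "v \<in> A" using p component_A[OF H] v by auto
  have ne: "w \<noteq> u" "w \<notin> H" "w \<notin> A" using w(1) u_B AB component_A[OF H] by auto
  have "has_C6T"
  proof (rule has_C6TI[of u b c v w a t])
    show "distinct [u, b, c, v, w, a, t]"
      using p(1,2) mem ne u_A a(1) aH v by auto
    show "u \<sim> b" "a \<sim> u" "t \<sim> u" using adj_u_iff adj_u_iff' mem a(1) by auto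
  qed (use p w a adj_sym in blast)+
  with no_C6T show False ..
qed

text \<open>If \<open>v\<close> and \<open>v'\<close> are adjacent, \<open>w\<close> is the apex over the edge \<open>vv'\<close> of a hexagon through \<open>u\<close> and
  the other three vertices. Otherwise \<open>vv'\<close> is the missing edge, and \<open>w\<close> serves as a detour between
  \<open>v\<close> and \<open>v'\<close> on a hexagon.\<close>
lemma near_K5_one_contact:
  assumes H: "component H" and D: "near_K5 H" and v: "v \<in> H" "v' \<in> H"
    and w: "w \<in> B" "w \<sim> v" "w \<sim> v'"
  shows "v = v'"
proof (rule ccontr)
  assume ne: "v \<noteq> v'"
  obtain p q r where l: "H = {v, v', p, q, r}" "distinct [v, v', p, q, r]"
    using three_others[of H v v'] D v ne unfolding near_K5_def by blast
  note miss = near_K5_missing[OF H D]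
  have mem: "p \<in> H" "q \<in> H" "r \<in> H" using l(1) by auto
  have memA: "p \<in> A" "q \<in> A" "r \<in> A" "v \<in> A" "v' \<in> A" using mem v component_A[OF H] by auto
  have wne: "w \<noteq> u" "w \<notin> H" using w(1) u_B AB component_A[OF H] by auto
  have uH: "u \<notin> H" using u_A component_A[OF H] by auto
  have wr: "v \<sim> w" "v' \<sim> w" using w adj_sym by auto
  have through: has_C6T
    if "v \<sim> v'" "i \<sim> j" "j \<sim> k" "k \<sim> v" and ijk: "{i, j, k} \<subseteq> H" "distinct [v, v', i, j, k]" for i j k
  proof -
    have iA: "i \<in> A" using ijk(1) component_A[OF H] by auto
    have e: "v' \<sim> u" "u \<sim> i" using iA memA(5) adj_u_iff adj_u_iff' by blast+
    have d: "distinct [v, v', u, i, j, k, w]" using ijk wne uH v by auto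
    show ?thesis by (rule has_C6TI[OF d that(1) e that(2-4) w(2,3)])
  qed
  consider "\<not> v \<sim> v'" | "v \<sim> v'" "\<not> p \<sim> q" | "v \<sim> v'" "\<not> q \<sim> r" | "v \<sim> v'" "\<not> r \<sim> v"
    | "v \<sim> v'" "p \<sim> q" "q \<sim> r" "r \<sim> v" by blast
  then have has_C6T
  proof cases
    case 1
    have e: "p \<sim> q" "v' \<sim> p" "r \<sim> p" "r \<sim> q"
      by (rule miss[of v v']; use 1 l(2) mem v in \<open>auto simp: doubleton_eq_iff\<close>)+
    have uu: "q \<sim> u" "u \<sim> v" using memA adj_u_iff adj_u_iff' by blast+
    have d: "distinct [p, q, u, v, w, v', r]" using l(2) wne uH mem v by auto
    show ?thesis by (rule has_C6TI[OF d e(1) uu wr(1) w(3) e(2-4)])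
  next
    case 2
    have "p \<sim> r" "r \<sim> q" "q \<sim> v"
      by (rule miss[of p q]; use 2 l(2) mem v in \<open>auto simp: doubleton_eq_iff\<close>)+
    then show ?thesis using through[of p r q] 2 l(2) mem by auto
  next
    case 3
    have "q \<sim> p" "p \<sim> r" "r \<sim> v"
      by (rule miss[of q r]; use 3 l(2) mem v in \<open>auto simp: doubleton_eq_iff\<close>)+
    then show ?thesis using through[of q p r] 3 l(2) mem by auto
  next
    case 4
    have "r \<sim> q" "q \<sim> p" "p \<sim> v"
      by (rule miss[of r v]; use 4 l(2) mem v in \<open>auto simp: doubleton_eq_iff\<close>)+
    then show ?thesis using through[of r q p] 4 l(2) mem by auto
  next
    case 5
    then show ?thesis using through[of p q r] l(2) mem by auto
  qed
  with no_C6T show False ..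
qed

lemma near_K5_dg:
  assumes H: "component H" and D: "near_K5 H" and v: "v \<in> H"
  shows "2 \<le> dg H v" "dg H v \<le> 4"
proof -
  note fin = component_fin[OF H]
  have c5: "card H = 5" "18 \<le> degsum H" using D by (auto simp: near_K5_def)
  have le4: "dg H w \<le> 4" if "w \<in> H" for w using dg_le_card_minus[OF fin that] c5 by simp
  have "degsum H = dg H v + (\<Sum>w\<in>H - {v}. dg H w)"
    unfolding degsum_def by (rule sum.remove[OF fin v])
  also have "(\<Sum>w\<in>H - {v}. dg H w) \<le> of_nat (card (H - {v})) * 4"
    by (rule sum_bounded_above) (use le4 in auto)
  finally show "2 \<le> dg H v" using c5 v by simp
  show "dg H v \<le> 4" by (rule le4[OF v])
qed

lemma near_K5_nonpos:
  assumes H: "component H" and D: "near_K5 H"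
  shows "sum excess H \<le> 0"
proof -
  have c5: "card H = 5" using D by (auto simp: near_K5_def)
  have "inner_excess v \<le> real (dg H v) / 2 - 2 \<and> real (dg H v) / 2 - 2 \<le> 0" if v: "v \<in> H" for v
    using inner_excess_big[of v] near_K5_dg[OF H D v] component_nbs[OF H v] component_A[OF H] v by auto
  then have "sum inner_excess H \<le> 0" by (intro sum_nonpos) force
  then show ?thesis using sum_excess_le_inner_excess[of H] by linarith
qed

text \<open>With few edges in \<open>B\<close>, an outer neighbour of the component sees one vertex of \<open>A\<close> and at most
  three of \<open>B\<close>, so its entry is at most \<open>4 / 7\<close>. Then the eigenvalue equation, with \<open>l \<ge> 7\<close> against
  at most four inner neighbours, bounds the sum \<open>S\<close> of the entries on the component in terms of the
  sum \<open>T\<close> of the entries at the outer neighbours. The charge for the edges to \<open>B\<close> outweighs \<open>T\<close>.\<close>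
lemma near_K5_drop:
  assumes H: "component H" and D: "near_K5 H" and few: "degsum B \<le> 6"
  shows "sum excess H \<le> -3"
proof -
  note fin = component_fin[OF H] and HA = component_A[OF H]
  have HV: "H \<subseteq> V" using HA A_V by blast
  have c5: "card H = 5" "18 \<le> degsum H" using D by (auto simp: near_K5_def)
  have small: "x w \<le> 4 / 7" if v: "v \<in> H" and w: "w \<in> nbs B v" for v w
  proof -
    have wB: "w \<in> B" "w \<sim> v" using w adj_sym by (auto simp: nbs_def)
    have "nbs A w = {v}"
    proof
      show "nbs A w \<subseteq> {v}"
      proof
        fix a assume "a \<in> nbs A w"
        then have a: "a \<in> A" "w \<sim> a" by (auto simp: nbs_def)
        have "a \<in> H" by (rule near_K5_no_exit[OF H D v wB a])
        then show "a \<in> {v}" using near_K5_one_contact[OF H D v _ wB a(2)] by simp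
      qed
      show "{v} \<subseteq> nbs A w" using v HA wB by (auto simp: nbs_def)
    qed
    then have eq: "l * x w = x v + sum x (nbs B w)" using eig_B[OF wB(1)] by simp
    have "2 * dg B w \<le> degsum B" using degsum_remove[OF fin_B wB(1)] by simp
    then have "dg B w \<le> 3" using few by linarith
    moreover have "nbs B w \<subseteq> V" using nbs_sub B_V by blast
    ultimately have "sum x (nbs B w) \<le> 3" using sum_x_le_card[of "nbs B w"] by linarith
    moreover have "x v \<le> 1" using x_le1 v HV by blast
    moreover have "7 * x w \<le> l * x w"
      using l_ge7 x_nonneg wB B_V by (intro mult_right_mono) auto
    ultimately show ?thesis using eq by linarith
  qed
  define S where "S = sum x H"
  define T where "T = (\<Sum>v\<in>H. sum x (nbs B v))"
  define R where "R = (\<Sum>v\<in>H. \<Sum>w\<in>nbs B v. 1 - x w)"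
  have "0 \<le> sum x (nbs B v)" for v using nbs_sub B_V by (intro sum_x_nonneg) blast
  then have T0: "0 \<le> T" unfolding T_def by (rule sum_nonneg)
  have "3 / 4 * sum x (nbs B v) \<le> (\<Sum>w\<in>nbs B v. 1 - x w)" if v: "v \<in> H" for v
    unfolding sum_distrib_left
  proof (rule sum_mono)
    fix w assume "w \<in> nbs B v"
    then show "3 / 4 * x w \<le> 1 - x w" using small[OF v] by fastforce
  qed
  then have R: "3 / 4 * T \<le> R" unfolding T_def R_def sum_distrib_left[of _ _ H] by (rule sum_mono)
  have "l * S = (\<Sum>v\<in>H. l * x v)" unfolding S_def by (rule sum_distrib_left)
  also have "\<dots> = (\<Sum>v\<in>H. 1 + sum x (nbs H v) + sum x (nbs B v))"
  proof (rule sum.cong)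
    fix v assume v: "v \<in> H"
    then have "v \<in> A" using HA by blast
    then show "l * x v = 1 + sum x (nbs H v) + sum x (nbs B v)"
      using eig_A component_nbs[OF H v] by simp
  qed simp
  also have "\<dots> \<le> (\<Sum>v\<in>H. 1 + (S - x v) + sum x (nbs B v))"
  proof (intro sum_mono add_right_mono add_left_mono)
    fix v assume v: "v \<in> H"
    have "sum x (nbs H v) \<le> sum x (H - {v})"
      using fin adj_irrefl x_nonneg HV by (intro sum_mono2) (auto simp: nbs_def)
    also have "\<dots> = S - x v" unfolding S_def using sum.remove[OF fin v, of x] by simp
    finally show "sum x (nbs H v) \<le> S - x v" .
  qed
  also have "\<dots> = 5 + 4 * S + T"
    by (simp add: sum.distrib sum_subtractf c5 T_def flip: S_def)
  finally have "l * S \<le> 5 + 4 * S + T" .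
  moreover have "7 * S \<le> l * S"
    using l_ge7 sum_x_nonneg[OF HV] unfolding S_def by (intro mult_right_mono) auto
  ultimately have S: "3 * S \<le> 5 + T" by linarith
  have "sum inner_excess H \<le> (\<Sum>v\<in>H. 2 * x v - real (dg H v) / 2)"
  proof (rule sum_mono)
    fix v assume v: "v \<in> H"
    have "(real (dg H v) - 2) * x v \<le> 2 * x v"
      using near_K5_dg[OF H D v] x_nonneg HV v by (intro mult_right_mono) auto
    then show "inner_excess v \<le> 2 * x v - real (dg H v) / 2"
      unfolding inner_excess_def component_nbs[OF H v] by simp
  qed
  also have "\<dots> = 2 * S - real (degsum H) / 2"
    by (simp add: sum_subtractf S_def degsum_def flip: sum_divide_distrib sum_distrib_left)
  finally have "sum inner_excess H \<le> 2 * S - 9" using c5 by linarith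
  moreover have "sum excess H = sum inner_excess H - R" by (simp add: excess_def R_def sum_subtractf)
  ultimately show ?thesis using S T0 R by linarith
qed

section \<open>The total excess\<close>

lemma component_partition:
  obtains P where "finite P" "\<And>H. H \<in> P \<Longrightarrow> component H"
    "\<And>f :: 'a \<Rightarrow> real. sum f A = (\<Sum>H\<in>P. sum f H)"
proof -
  have "closed_in_A A" unfolding closed_in_A_def using nbs_sub by blast
  from closed_partition[OF this] obtain P where
    P: "finite P" "disjoint P" "\<Union>P = A" "\<forall>H\<in>P. component H" by (elim exE conjE)
  have "sum f (\<Union>P) = (\<Sum>H\<in>P. sum f H)" for f :: "'a \<Rightarrow> real"
  proof -
    have "\<forall>H\<in>P. finite H" using P(4) component_fin by blast
    moreover have "\<forall>H\<in>P. \<forall>J\<in>P. H \<noteq> J \<longrightarrow> H \<inter> J = {}"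
      using P(2) unfolding pairwise_def disjnt_def by blast
    ultimately show ?thesis by (simp add: sum.Union_disjoint)
  qed
  then show ?thesis using that[of P] P(1,3,4) by simp
qed

text \<open>In a first round all excesses are seen to be nonpositive. This limits \<open>B\<close> to three edges, which
  is the hypothesis of \<open>near_K5_drop\<close> in the second round.\<close>
lemma components_within_budget:
  assumes hyp: "degsum V / 2 - 3 \<le> l^2 - 2 * l" and H: "component H"
  shows "within_budget H"
proof -
  obtain P where P: "finite P" "\<And>H. H \<in> P \<Longrightarrow> component H"
    "\<And>f :: 'a \<Rightarrow> real. sum f A = (\<Sum>H\<in>P. sum f H)" by (rule component_partition) (rule that)
  have "sum excess A = (\<Sum>H\<in>P. sum excess H)" by (rule P(3))
  also have "\<dots> \<le> 0"
  proof (rule sum_nonpos)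
    fix J assume "J \<in> P"
    then have J: "component J" by (rule P(2))
    have "0 \<le> sum x J" using component_A[OF J] A_V by (intro sum_x_nonneg) auto
    then have "sum excess J \<le> 0" if "within_budget J" using that unfolding within_budget_def by linarith
    then show "sum excess J \<le> 0"
      using component_within_budget_or_near_K5[OF J] near_K5_nonpos[OF J] by blast
  qed
  finally have "sum excess A \<le> 0" .
  then have few: "degsum B \<le> 6" using sum_excess hyp by linarith
  show ?thesis
  proof (cases "near_K5 H")
    case True
    have "H \<subseteq> V" using component_A[OF H] A_V by blast
    then have "sum x H \<le> 5" using sum_x_le_card[of H] True by (simp add: near_K5_def)
    then show ?thesis using near_K5_drop[OF H True few] unfolding within_budget_def by linarith
  next
    case False
    then show ?thesis using component_within_budget_or_near_K5[OF H] by blast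
  qed
qed

text \<open>Components of the first kind in \<open>within_budget\<close> lose their entries, and the entries on \<open>A\<close> have
  sum \<open>l\<close>. So the total is at most \<open>- l\<close> if all are of the first kind, at most \<open>-4\<close> if two are
  not, and at most \<open>sum excess H + sum x H - l\<close> if exactly one component \<open>H\<close> is not.\<close>
lemma sum_excess_A:
  assumes hyp: "degsum V / 2 - 3 \<le> l^2 - 2 * l"
  shows "sum excess A < -3 \<or> (sum excess A = -3 \<and> sum inner_excess A \<le> -3 \<and> K2_join A)"
proof -
  obtain P where P: "finite P" "\<And>H. H \<in> P \<Longrightarrow> component H"
    and Psum: "\<And>f :: 'a \<Rightarrow> real. sum f A = (\<Sum>H\<in>P. sum f H)"
    by (rule component_partition) (rule that)
  have within_budget: "within_budget H" if "H \<in> P" for H by (rule components_within_budget[OF hyp P(2)[OF that]])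
  have x0: "0 \<le> sum x H" if "H \<in> P" for H
    using component_A[OF P(2)[OF that]] A_V by (intro sum_x_nonneg) blast
  have neg: "sum excess H \<le> 0" if "H \<in> P" for H
    using within_budget[OF that] x0[OF that] unfolding within_budget_def by linarith
  define N where "N = {H \<in> P. \<not> sum excess H \<le> - sum x H}"
  have N2: "sum excess H \<le> -2" if "H \<in> N" for H
    using that within_budget[of H] unfolding N_def within_budget_def by auto
  consider "N = {}" | H1 H2 where "H1 \<in> N" "H2 \<in> N" "H1 \<noteq> H2" | H where "N = {H}" by blast
  then show ?thesis
  proof cases
    case 1
    have "sum excess A \<le> (\<Sum>H\<in>P. - sum x H)"
      unfolding Psum by (rule sum_mono) (use 1 in \<open>auto simp: N_def\<close>)
    also have "\<dots> = - l" using Psum[of x] sum_A by (simp add: sum_negf)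
    finally show ?thesis using l_ge7 by linarith
  next
    case (2 H1 H2)
    have sub: "{H1, H2} \<subseteq> P" using 2 by (auto simp: N_def)
    have "sum excess A = (\<Sum>H\<in>P - {H1, H2}. sum excess H) + (\<Sum>H\<in>{H1, H2}. sum excess H)"
      unfolding Psum by (rule sum.subset_diff[OF sub P(1)])
    moreover have "(\<Sum>H\<in>P - {H1, H2}. sum excess H) \<le> 0" by (rule sum_nonpos) (auto simp: neg)
    ultimately show ?thesis using 2(3) N2[OF 2(1)] N2[OF 2(2)] by simp
  next
    case (3 H)
    then have HP: "H \<in> P" and HN: "H \<in> N" by (auto simp: N_def)
    have eqs: "sum f A = sum f H + (\<Sum>J\<in>P - {H}. sum f J)" for f :: "'a \<Rightarrow> real"
      unfolding Psum by (rule sum.remove[OF P(1) HP])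
    have "(\<Sum>J\<in>P - {H}. sum excess J) \<le> (\<Sum>J\<in>P - {H}. - sum x J)"
      by (rule sum_mono) (use 3 in \<open>auto simp: N_def\<close>)
    then have tot: "sum excess A \<le> sum excess H + sum x H - l"
      using eqs[of excess] eqs[of x] sum_A by (simp add: sum_negf)
    have "0 \<le> (\<Sum>J\<in>P - {H}. sum x J)" by (rule sum_nonneg) (auto simp: x0)
    then have rest: "sum x H \<le> l" using eqs[of x] sum_A by linarith
    have "sum excess H + sum x H \<le> 3 \<or> sum excess H < -3 \<or> (sum inner_excess H \<le> -3 \<and> K2_join H)"
      using within_budget[OF HP] HN unfolding within_budget_def N_def by blast
    then show ?thesis
    proof (elim disjE)
      assume "sum excess H + sum x H \<le> 3"
      then show ?thesis using tot l_ge7 by linarith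
    next
      assume "sum excess H < -3"
      then show ?thesis using tot rest by linarith
    next
      assume star: "sum inner_excess H \<le> -3 \<and> K2_join H"
      then have le: "sum excess H \<le> -3" using sum_excess_le_inner_excess[of H] by linarith
      show ?thesis
      proof (cases "H = A")
        case True
        then show ?thesis using star le by auto
      next
        case False
        have HA: "H \<subseteq> A" by (rule component_A[OF P(2)[OF HP]])
        then obtain v where v: "v \<in> A - H" using False by blast
        have "0 < sum x (A - H)"
          by (rule sum_pos2[of _ v]) (use v fin_A x_pos in \<open>auto simp: less_imp_le\<close>)
        moreover have "sum x A = sum x (A - H) + sum x H" by (rule sum.subset_diff[OF HA fin_A])
        ultimately have "sum x H < l" using sum_A by linarith
        then show ?thesis using tot le by linarith
      qed
    qed
  qed
qed

text \<open>Equality in \<open>sum_excess_A\<close> leaves no edge inside \<open>B\<close> and no charge for edges to \<open>B\<close>. A vertex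
  \<open>w\<close> of \<open>B\<close> therefore has entry 1, and as the entries on \<open>A\<close> are positive with sum \<open>l\<close>, it is adjacent
  to all of \<open>A\<close>. Then \<open>u\<close> and \<open>w\<close> have the same neighbours, and the forbidden graph appears.\<close>
lemma eigenvalue_bound:
  assumes hyp: "degsum V / 2 - 3 \<le> l^2 - 2 * l"
  shows "l^2 - 2 * l = degsum V / 2 - 3 \<and> K3_join"
proof -
  have "-3 \<le> sum excess A" using sum_excess hyp by linarith
  then have eq: "sum excess A = -3" "sum inner_excess A \<le> -3" "K2_join A" using sum_excess_A[OF hyp] by auto
  then have B0: "degsum B = 0" and l_eq: "l^2 - 2 * l = degsum V / 2 - 3" using sum_excess hyp by auto
  obtain a c where ac: "a \<in> A" "c \<in> A" "a \<sim> c" and star: "\<forall>v\<in>A - {a, c}. nbs A v = {a, c}"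
    using eq(3) unfolding K2_join_def by blast
  have anec: "a \<noteq> c" using ac adj_neq by blast
  have "B = {}"
  proof (rule ccontr)
    assume "B \<noteq> {}"
    then obtain w where w: "w \<in> B" by blast
    have "dg B w = 0" using degsum_remove[OF fin_B w] B0 by simp
    then have nB: "nbs B w = {}" using finite_nbs[OF fin_B] by simp
    then obtain v where "v \<in> nbs A w" using no_isolated[of w] nbs_V_B[OF w] w B_V by blast
    then have v: "v \<in> A" "w \<in> nbs B v" using w adj_sym by (auto simp: nbs_def)
    define g where "g = (\<lambda>v. \<Sum>w\<in>nbs B v. 1 - x w)"
    have xw: "0 \<le> 1 - x w" if "w \<in> nbs B v" for v w using x_le1 that B_V by (auto simp: nbs_def)
    have g0: "0 \<le> g v" for v unfolding g_def by (rule sum_nonneg) (rule xw)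
    have "sum g A \<le> 0" using eq(1,2) by (simp add: excess_def g_def sum_subtractf)
    moreover have "g v \<le> sum g A" by (rule member_le_sum) (use v g0 fin_A in auto)
    moreover have "1 - x w \<le> g v" unfolding g_def
      by (rule member_le_sum) (use v xw finite_nbs[OF fin_B] in auto)
    ultimately have "1 \<le> x w" by linarith
    then have "x w = 1" using x_le1 w B_V by (auto intro: antisym)
    then have full: "sum x (nbs A w) = sum x A" using eig_B[OF w] nB sum_A by simp
    have nA: "nbs A w = A"
    proof (rule ccontr)
      assume "nbs A w \<noteq> A"
      then obtain z where z: "z \<in> A - nbs A w" using nbs_sub by blast
      have "0 < sum x (A - nbs A w)"
        by (rule sum_pos2[of _ z]) (use z fin_A x_pos in \<open>auto simp: less_imp_le\<close>)
      then show False using full sum.subset_diff[OF nbs_sub[of A w] fin_A, of x] by linarith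
    qed
    have wA: "w \<sim> y" "y \<sim> w" "u \<sim> y" "y \<sim> u" if "y \<in> A" for y
      using nA that adj_sym adj_u_iff unfolding nbs_def by blast+
    have "real (card A) \<ge> 7" using sum_A sum_x_le_card[OF A_V] l_ge7 by linarith
    then have "5 \<le> card (A - {a, c})" using ac anec fin_A by (simp add: card_Diff_subset)
    then obtain S where S: "S \<subseteq> A - {a, c}" "card S = 3" using obtain_subset_with_card_n[of 3 "A - {a, c}"] by auto
    then obtain p q r where pqr: "S = {p, q, r}" "p \<noteq> q" "q \<noteq> r" "p \<noteq> r" by (auto simp: card_3_iff)
    have sp: "y \<sim> a" "y \<sim> c" "a \<sim> y" "c \<sim> y" if "y \<in> A - {a, c}" for y
      using star that adj_sym unfolding nbs_def by blast+
    have mem: "p \<in> A - {a, c}" "q \<in> A - {a, c}" "r \<in> A - {a, c}" using S pqr by auto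
    have "has_C6T"
    proof (rule has_C6TI[of a c p u q w r])
      show "distinct [a, c, p, u, q, w, r]"
        using pqr mem anec ac u_A u_B w AB by auto
    qed (use ac mem sp wA in auto)
    with no_C6T show False ..
  qed
  then have VA: "V = insert u A" using V_split by simp
  have "K3_join" unfolding K3_join_def
  proof (intro exI conjI ballI)
    show "{u, a, c} \<subseteq> V" "distinct [u, a, c]" using ac anec u_A VA by auto
    show "u \<sim> a" "a \<sim> c" "u \<sim> c" using ac adj_u_iff by auto
    fix v assume v: "v \<in> V - {u, a, c}"
    then have "v \<in> A" "nbs A v = {a, c}" using VA star by auto
    then show "nbs V v = {u, a, c}" using nbs_V[of v] \<open>B = {}\<close> by (simp add: nbs_def)
  qed
  with l_eq show ?thesis by blast
qed

end

context simple_graph begin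

section \<open>A nonnegative eigenvector from the Rayleigh quotient\<close>

definition nbr_sum :: "('a \<Rightarrow> real) \<Rightarrow> 'a \<Rightarrow> real" where
  "nbr_sum z v = (\<Sum>w\<in>nbs V v. z w)"

definition quad_form :: "('a \<Rightarrow> real) \<Rightarrow> real" where
  "quad_form z = (\<Sum>v\<in>V. z v * nbr_sum z v)"

definition sq_norm :: "('a \<Rightarrow> real) \<Rightarrow> real" where
  "sq_norm z = (\<Sum>v\<in>V. (z v)\<^sup>2)"

text \<open>Vectors are functions that vanish outside \<open>V\<close>, so compactness comes from Tychonoff's theorem for
  the product topology on functions.\<close>
lemma compact_unit_vectors:
  "compact {z :: 'a \<Rightarrow> real. (\<forall>v. z v \<in> (if v \<in> V then {0..1} else {0})) \<and> sq_norm z = 1}"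
proof -
  let ?box = "Pi\<^sub>E UNIV (\<lambda>v. if v \<in> V then {0..1 :: real} else {0})"
  have "compactin (product_topology (\<lambda>v :: 'a. euclidean :: real topology) UNIV) ?box"
    by (subst compactin_PiE) auto
  then have "compact ?box" by (simp add: euclidean_product_topology)
  moreover have "closed {z :: 'a \<Rightarrow> real. sq_norm z = 1}"
    unfolding sq_norm_def by (intro closed_Collect_eq continuous_intros continuous_on_product_coordinates)
  ultimately have "compact (?box \<inter> {z. sq_norm z = 1})" by (rule compact_Int_closed)
  moreover have "?box \<inter> {z. sq_norm z = 1} = {z. (\<forall>v. z v \<in> (if v \<in> V then {0..1} else {0})) \<and> sq_norm z = 1}"
    by (auto simp: PiE_def Pi_def)
  ultimately show ?thesis by simp
qed

lemma continuous_quad: "continuous_on S quad_form"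
proof -
  have "continuous_on UNIV quad_form" unfolding quad_form_def nbr_sum_def
    by (intro continuous_intros continuous_on_product_coordinates)
  then show ?thesis by (rule continuous_on_subset) simp
qed

text \<open>Replacing a vector by its entrywise absolute value does not decrease the quadratic form, so the
  maximum over nonnegative unit vectors bounds the form on all vectors.\<close>
lemma quad_maximiser:
  assumes "V \<noteq> {}"
  obtains z where "\<And>v. v \<in> V \<Longrightarrow> 0 \<le> z v" "sq_norm z = 1" "\<And>h. quad_form h \<le> quad_form z * sq_norm h"
proof -
  let ?K = "{z :: 'a \<Rightarrow> real. (\<forall>v. z v \<in> (if v \<in> V then {0..1} else {0})) \<and> sq_norm z = 1}"
  obtain v0 where v0: "v0 \<in> V" using assms by blast
  define e where "e = (\<lambda>v. if v = v0 then 1 else 0 :: real)"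
  have "sq_norm e = (\<Sum>v\<in>V. if v = v0 then 1 else 0)"
    unfolding sq_norm_def e_def by (rule sum.cong) auto
  then have "sq_norm e = 1" using v0 finite_V by simp
  moreover have "\<forall>v. e v \<in> (if v \<in> V then {0..1} else {0})" using v0 by (auto simp: e_def)
  ultimately have "e \<in> ?K" by blast
  then have ne: "?K \<noteq> {}" by (metis emptyE)
  obtain z where z: "z \<in> ?K" and max: "\<And>y. y \<in> ?K \<Longrightarrow> quad_form y \<le> quad_form z"
    using continuous_attains_sup[OF compact_unit_vectors ne continuous_quad] by blast
  have "quad_form h \<le> quad_form z * sq_norm h" for h
  proof (cases "sq_norm h = 0")
    case True
    then have "\<forall>v\<in>V. h v = 0" unfolding sq_norm_def using finite_V
      by (subst (asm) sum_nonneg_eq_0_iff) auto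
    then show ?thesis using True by (simp add: quad_form_def)
  next
    case False
    have sq0: "0 \<le> sq_norm h" unfolding sq_norm_def by (intro sum_nonneg) simp
    define s where "s = sqrt (sq_norm h)"
    have s: "0 < s" "s\<^sup>2 = sq_norm h" using False sq0 by (auto simp: s_def)
    define y where "y = (\<lambda>v. if v \<in> V then \<bar>h v\<bar> / s else 0)"
    have ysq: "sq_norm y = 1"
    proof -
      have "sq_norm y = (\<Sum>v\<in>V. (h v)\<^sup>2 / s\<^sup>2)"
        unfolding sq_norm_def y_def by (intro sum.cong) (auto simp: power_divide)
      also have "\<dots> = sq_norm h / s\<^sup>2" by (simp add: sq_norm_def sum_divide_distrib)
      finally show ?thesis using s False by simp
    qed
    have "y v \<le> 1" if v: "v \<in> V" for v
    proof -
      have "(y v)\<^sup>2 \<le> sq_norm y" unfolding sq_norm_def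
        by (rule member_le_sum) (use v finite_V in auto)
      then have "(y v)\<^sup>2 \<le> 1\<^sup>2" using ysq by simp
      then show ?thesis by (rule power2_le_imp_le) simp
    qed
    then have "y \<in> ?K" using s ysq by (auto simp: y_def)
    then have le: "quad_form y \<le> quad_form z" by (rule max)
    have "quad_form h \<le> (\<Sum>v\<in>V. \<bar>h v\<bar> * (\<Sum>w\<in>nbs V v. \<bar>h w\<bar>))"
      unfolding quad_form_def
    proof (rule sum_mono)
      fix v
      have "h v * nbr_sum h v \<le> \<bar>h v\<bar> * \<bar>nbr_sum h v\<bar>" by (metis abs_ge_self abs_mult)
      also have "\<dots> \<le> \<bar>h v\<bar> * (\<Sum>w\<in>nbs V v. \<bar>h w\<bar>)"
        unfolding nbr_sum_def by (rule mult_left_mono[OF sum_abs]) simp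
      finally show "h v * nbr_sum h v \<le> \<bar>h v\<bar> * (\<Sum>w\<in>nbs V v. \<bar>h w\<bar>)" .
    qed
    also have "\<dots> = s\<^sup>2 * quad_form y"
    proof -
      have n: "nbr_sum y v = (\<Sum>w\<in>nbs V v. \<bar>h w\<bar>) / s" for v
        unfolding nbr_sum_def sum_divide_distrib by (rule sum.cong) (auto simp: y_def nbs_def)
      have "s\<^sup>2 * quad_form y = (\<Sum>v\<in>V. s\<^sup>2 * (y v * nbr_sum y v))"
        unfolding quad_form_def by (rule sum_distrib_left)
      also have "\<dots> = (\<Sum>v\<in>V. \<bar>h v\<bar> * (\<Sum>w\<in>nbs V v. \<bar>h w\<bar>))"
      proof (rule sum.cong[OF refl])
        fix v assume "v \<in> V"
        then have "y v = \<bar>h v\<bar> / s" by (simp add: y_def)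
        then show "s\<^sup>2 * (y v * nbr_sum y v) = \<bar>h v\<bar> * (\<Sum>w\<in>nbs V v. \<bar>h w\<bar>)"
          unfolding n using s(1) by (simp add: power2_eq_square)
      qed
      finally show ?thesis by simp
    qed
    also have "\<dots> \<le> s\<^sup>2 * quad_form z" using le by (rule mult_left_mono) simp
    finally show ?thesis using s by (simp add: mult.commute)
  qed
  moreover have "0 \<le> z v" if "v \<in> V" for v using z that by (auto dest: spec[of _ v])
  ultimately show ?thesis using z that by blast
qed

text \<open>First variation in the direction of a single vertex. The quadratic form has no term of second
  order in \<open>t\<close> because there are no loops.\<close>
lemma maximiser_eigenvector:
  assumes sq: "sq_norm z = 1" and max: "\<And>h. quad_form h \<le> quad_form z * sq_norm h" and v: "v \<in> V"
  shows "nbr_sum z v = quad_form z * z v"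
proof -
  define c where "c = nbr_sum z v - quad_form z * z v"
  have var: "2 * t * c \<le> quad_form z * t\<^sup>2" for t
  proof -
    define h where "h = (\<lambda>w. z w + (if w = v then t else 0))"
    have n: "nbr_sum h a = nbr_sum z a + (if a \<sim> v then t else 0)" for a
      using v finite_V by (simp add: nbr_sum_def h_def sum.distrib nbs_def)
    have col: "(\<Sum>a\<in>V. z a * (if a \<sim> v then t else 0)) = t * nbr_sum z v"
    proof -
      have "(\<Sum>a\<in>V. z a * (if a \<sim> v then t else 0)) = (\<Sum>a\<in>V. if v \<sim> a then t * z a else 0)"
        by (rule sum.cong) (auto simp: adj_commute)
      also have "\<dots> = (\<Sum>a\<in>nbs V v. t * z a)"
        using finite_V by (simp add: nbs_def sum.If_cases Int_def)
      finally show ?thesis by (simp add: nbr_sum_def sum_distrib_left)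
    qed
    have "quad_form h = (\<Sum>a\<in>V. z a * nbr_sum z a + z a * (if a \<sim> v then t else 0) + (if a = v then t * nbr_sum z v else 0))"
      unfolding quad_form_def n using adj_irrefl by (intro sum.cong) (auto simp: h_def algebra_simps)
    also have "\<dots> = quad_form z + 2 * t * nbr_sum z v"
      using v finite_V by (simp add: sum.distrib col quad_form_def)
    finally have q: "quad_form h = quad_form z + 2 * t * nbr_sum z v" .
    have "sq_norm h = (\<Sum>a\<in>V. (z a)\<^sup>2 + (if a = v then 2 * t * z v + t\<^sup>2 else 0))"
      unfolding sq_norm_def by (intro sum.cong) (auto simp: h_def power2_sum algebra_simps)
    also have "\<dots> = 1 + 2 * t * z v + t\<^sup>2"
      using v finite_V sq by (simp add: sum.distrib sq_norm_def)
    finally have "sq_norm h = 1 + 2 * t * z v + t\<^sup>2" .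
    with max[of h] q show ?thesis by (simp add: c_def algebra_simps)
  qed
  \<comment> \<open>The step \<open>t = c / b\<close> makes the linear term dominate the quadratic one unless \<open>c = 0\<close>.\<close>
  define b where "b = \<bar>quad_form z\<bar> + 1"
  have b: "0 < b" "quad_form z \<le> b" by (auto simp: b_def)
  have "2 * (c / b) * c \<le> quad_form z * (c / b)\<^sup>2" by (rule var)
  also have "\<dots> \<le> b * (c / b)\<^sup>2" using b by (intro mult_right_mono) auto
  also have "\<dots> = (c / b) * c" using b by (simp add: power2_eq_square)
  finally have "(c / b) * c \<le> 0" by linarith
  then have "c\<^sup>2 / b \<le> 0" by (simp add: power2_eq_square)
  then have "c = 0" using b by (simp add: divide_le_0_iff)
  then show ?thesis by (simp add: c_def)
qed

end

section \<open>Graphs, copies and the spectral radius\<close>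

abbreviation has_arc :: "'a pair_pre_digraph \<Rightarrow> 'a \<Rightarrow> 'a \<Rightarrow> bool" where
  "has_arc G u v \<equiv> (u, v) \<in> parcs G"

lemma simple_graph_pair_graph:
  assumes "pair_graph G"
  shows "simple_graph (pverts G) (has_arc G)"
proof -
  interpret pair_graph G by fact
  show ?thesis
  proof
    show "finite (pverts G)" by (rule pair_finite_verts)
    show "has_arc G b a" if "has_arc G a b" for a b
      using that pair_sym_arcs by (simp add: symmetric_def sym_def)
    show "\<not> has_arc G a a" for a using pair_no_loops by fastforce
    show "a \<in> pverts G" if "has_arc G a b" for a b using that by (rule in_arcsD1)
  qed
qed

context simple_graph begin

lemma sum_nbs_eq_if: "(\<Sum>w\<in>nbs V v. f w) = (\<Sum>w\<in>V. if v \<sim> w then f w else 0)"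
  using finite_V by (simp add: nbs_def sum.If_cases Int_def)

lemma degsum_eq_card: "degsum V = card {(v, w). v \<sim> w}"
proof -
  have "{(v, w). v \<sim> w} = (SIGMA v:V. nbs V v)"
    using adj_V adj_sym unfolding nbs_def by blast
  then show ?thesis using finite_V finite_nbs[OF finite_V] by (simp add: degsum_def)
qed

end

text \<open>Every edge is the image of exactly two arcs.\<close>
lemma degsum_uedges:
  assumes G: "pair_graph G"
  shows "simple_graph.degsum (has_arc G) (pverts G) = 2 * card (uedges G)"
proof -
  interpret simple_graph "pverts G" "has_arc G" by (rule simple_graph_pair_graph[OF G])
  interpret pair_graph G by fact
  let ?e = "\<lambda>p. {fst p, snd p}"
  have U: "uedges G = ?e ` parcs G" unfolding uedges_def by force
  have "card (parcs G) = (\<Sum>p\<in>parcs G. 1)" by simp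
  also have "\<dots> = (\<Sum>e\<in>uedges G. \<Sum>p\<in>{p \<in> parcs G. ?e p = e}. 1)"
    by (rule sum.group[symmetric]) (use pair_finite_arcs U in auto)
  also have "\<dots> = (\<Sum>e\<in>uedges G. 2)"
  proof (rule sum.cong)
    fix e assume "e \<in> uedges G"
    then obtain a b where ab: "e = {a, b}" "(a, b) \<in> parcs G" unfolding uedges_def by blast
    have "{p \<in> parcs G. ?e p = e} = {(a, b), (b, a)}"
      using ab adj_sym[OF ab(2)] by (auto simp: doubleton_eq_iff)
    moreover have "(a, b) \<noteq> (b, a)" using adj_neq[OF ab(2)] by blast
    ultimately show "(\<Sum>p\<in>{p \<in> parcs G. ?e p = e}. 1) = (2 :: nat)" by simp
  qed simp
  finally have "card (parcs G) = 2 * card (uedges G)" by simp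
  moreover have "{(v, w). has_arc G v w} = parcs G" by auto
  ultimately show ?thesis using degsum_eq_card by simp
qed

text \<open>One orientation of each edge of the forbidden graph: the hexagon, followed by the two edges at the
  apex 6.\<close>
definition C6_triangle_edges :: "(nat \<times> nat) set" where
  "C6_triangle_edges = {(0, 1), (1, 2), (2, 3), (3, 4), (4, 5), (5, 0), (6, 0), (6, 1)}"

lemma C6_triangle_arcsE:
  assumes "(i, j) \<in> parcs C6_triangle"
  shows "(i, j) \<in> C6_triangle_edges \<or> (j, i) \<in> C6_triangle_edges"
proof -
  have cyc: "(i, (i + 1) mod 6) \<in> C6_triangle_edges" if "i < 6" for i
  proof -
    have "i = 0 \<or> i = 1 \<or> i = 2 \<or> i = 3 \<or> i = 4 \<or> i = 5" using that by linarith
    then show ?thesis by (elim disjE) (simp_all add: C6_triangle_edges_def)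
  qed
  have "(i, j) \<in> parcs (cycle_graph 6) \<or> (i, j) \<in> {(6, 0), (0, 6), (6, 1), (1, 6)}"
    using assms unfolding C6_triangle_def by auto
  then show ?thesis
  proof
    assume "(i, j) \<in> parcs (cycle_graph 6)"
    then have "i < 6" "j < 6" "j = (i + 1) mod 6 \<or> i = (j + 1) mod 6"
      unfolding cycle_graph_def by simp_all
    then show ?thesis using cyc[of i] cyc[of j] by metis
  next
    assume "(i, j) \<in> {(6, 0), (0, 6), (6, 1), (1, 6)}"
    then show ?thesis by (auto simp: C6_triangle_edges_def)
  qed
qed

lemma C6_triangle_verts: "pverts C6_triangle = {..<7}"
  unfolding C6_triangle_def cycle_graph_def by auto

text \<open>An injective homomorphism yields a copy, namely its image, which the inverse map identifies with
  the given graph.\<close>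
lemma contains_copyI:
  assumes G: "pair_graph G" and F: "pair_graph F"
    and g: "inj_on g (pverts F)" "g ` pverts F \<subseteq> pverts G"
    and arcs: "\<And>i j. (i, j) \<in> parcs F \<Longrightarrow> (g i, g j) \<in> parcs G"
  shows "contains_copy G F"
proof -
  interpret G: pair_graph G by fact
  interpret F: pair_graph F by fact
  define H where "H = \<lparr>pverts = g ` pverts F, parcs = map_prod g g ` parcs F\<rparr>"
  have wfH: "pair_wf_digraph H"
    by unfold_locales (auto simp: H_def F.in_arcsD1 F.in_arcsD2)
  have "graph_iso H F"
    unfolding graph_iso_iff[OF wfH]
  proof (intro exI conjI)
    let ?k = "inv_into (pverts F) g"
    show "bij_betw ?k (pverts H) (pverts F)"
      unfolding H_def using g(1) by (simp add: bij_betw_inv_into inj_on_imp_bij_betw)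
    have "map_prod ?k ?k ` parcs H = (\<lambda>p. (?k (g (fst p)), ?k (g (snd p)))) ` parcs F"
      unfolding H_def by (simp add: image_image map_prod_def case_prod_beta)
    also have "\<dots> = (\<lambda>p. p) ` parcs F"
      using g(1) F.arc_fst_in_verts F.arc_snd_in_verts by (intro image_cong) auto
    finally show "parcs F = map_prod ?k ?k ` parcs H" by simp
  qed
  moreover have "subgraph (with_proj H) (with_proj G)"
    unfolding subgraph_def using wfH g(2) arcs G.wf_digraph_axioms
    by (auto simp: wf_digraph_wp_iff H_def intro: G.pair_wf_digraph_axioms)
  ultimately show ?thesis unfolding contains_copy_def by blast
qed

lemma contains_C6_triangle:
  assumes G: "pair_graph G" and C: "simple_graph.has_C6T (has_arc G)"
  shows "contains_copy G C6_triangle"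
proof -
  interpret simple_graph "pverts G" "has_arc G" by (rule simple_graph_pair_graph[OF G])
  obtain a b c d e f t where p: "distinct [a, b, c, d, e, f, t]"
    "has_arc G a b" "has_arc G b c" "has_arc G c d" "has_arc G d e" "has_arc G e f" "has_arc G f a" "has_arc G t a" "has_arc G t b"
    using C unfolding has_C6T_def by (elim exE conjE)
  define xs where "xs = [a, b, c, d, e, f, t]"
  have nth: "xs ! 0 = a" "xs ! Suc 0 = b" "xs ! 2 = c" "xs ! 3 = d" "xs ! 4 = e" "xs ! 5 = f" "xs ! 6 = t"
    by (simp_all add: xs_def)
  have len: "length xs = 7" by (simp add: xs_def)
  have edge: "has_arc G (xs ! i) (xs ! j)" if "(i, j) \<in> C6_triangle_edges" for i j
    using that p(2-) unfolding C6_triangle_edges_def by (elim insertE) (simp_all add: nth)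
  have arcs: "has_arc G (xs ! i) (xs ! j)" if "(i, j) \<in> parcs C6_triangle" for i j
    using C6_triangle_arcsE[OF that] edge adj_sym by blast
  show ?thesis
  proof (rule contains_copyI[OF G pair_graph_C6_triangle, of "(!) xs"])
    show "inj_on ((!) xs) (pverts C6_triangle)"
      using p(1) len unfolding C6_triangle_verts xs_def[symmetric] by (intro inj_on_nth) auto
    have "{a, b, c, d, e, f, t} \<subseteq> pverts G" using p(2-) adj_V by blast
    moreover have "(!) xs ` pverts C6_triangle = set xs"
      using nth_image[of 7 xs] len by (simp add: C6_triangle_verts atLeast0LessThan)
    ultimately show "(!) xs ` pverts C6_triangle \<subseteq> pverts G" by (simp add: xs_def)
  qed (rule arcs)
qed

lemma eigenvalue_graph:
  assumes G: "pair_graph G" and vs: "distinct vs" "set vs = pverts G"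
  shows "eigenvalue (adjacency_mat vs G) k \<longleftrightarrow>
    (\<exists>f. (\<exists>v\<in>pverts G. f v \<noteq> 0) \<and>
      (\<forall>v\<in>pverts G. (\<Sum>w\<in>simple_graph.nbs (has_arc G) (pverts G) v. f w) = k * f v))"
  unfolding eigenvalue_adjacency_mat_iff[OF vs]
    simple_graph.sum_nbs_eq_if[OF simple_graph_pair_graph[OF G]] ..

lemma eigenvalue_le_spectral_radius:
  assumes G: "pair_graph G" and v: "v \<in> pverts G" "f v \<noteq> 0"
    and f: "\<And>v. v \<in> pverts G \<Longrightarrow> (\<Sum>w\<in>simple_graph.nbs (has_arc G) (pverts G) v. f w) = k * f v"
  shows "\<bar>k\<bar> \<le> graph_spectral_radius G"
proof -
  interpret simple_graph "pverts G" "has_arc G" by (rule simple_graph_pair_graph[OF G])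
  obtain vs where vs: "distinct vs" "set vs = pverts G"
    using finite_distinct_list[OF finite_V] by blast
  let ?M = "adjacency_mat vs G"
  have M: "?M \<in> carrier_mat (length vs) (length vs)" by (simp add: adjacency_mat_def)
  have n: "0 < length vs" using v vs by force
  have "eigenvalue ?M (complex_of_real k)"
    unfolding eigenvalue_graph[OF G vs]
  proof (intro exI[of _ "\<lambda>v. complex_of_real (f v)"] conjI ballI)
    show "\<exists>v\<in>pverts G. complex_of_real (f v) \<noteq> 0" using v by auto
    fix v assume "v \<in> pverts G"
    then show "(\<Sum>w\<in>nbs (pverts G) v. complex_of_real (f w)) = complex_of_real k * complex_of_real (f v)"
      using f[of v] by (simp flip: of_real_sum of_real_mult)
  qed
  then have "cmod (complex_of_real k) \<in> norm ` spectrum ?M"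
    unfolding spectrum_def by blast
  then have "\<bar>k\<bar> \<le> spectral_radius ?M" using spectral_radius_mem_max(2)[OF M n] by simp
  then show ?thesis using graph_spectral_radius_eq[OF vs] by simp
qed

text \<open>If \<open>f\<close> is a complex eigenvector whose eigenvalue \<open>k\<close> has the largest modulus, the entrywise
  modulus of \<open>f\<close> has Rayleigh quotient at least \<open>cmod k\<close>, so \<open>cmod k\<close> is at most the maximum of the
  Rayleigh quotient. This maximum is itself an eigenvalue.\<close>
lemma perron_vector:
  assumes G: "pair_graph G" and ne: "pverts G \<noteq> {}"
  obtains z where "\<And>v. v \<in> pverts G \<Longrightarrow> (0::real) \<le> z v" "\<exists>v\<in>pverts G. z v \<noteq> 0"
    "\<And>v. v \<in> pverts G \<Longrightarrow>
      (\<Sum>w\<in>simple_graph.nbs (has_arc G) (pverts G) v. z w) = graph_spectral_radius G * z v"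
proof -
  interpret simple_graph "pverts G" "has_arc G" by (rule simple_graph_pair_graph[OF G])
  obtain z where z: "\<And>v. v \<in> pverts G \<Longrightarrow> 0 \<le> z v" "sq_norm z = 1" "\<And>h. quad_form h \<le> quad_form z * sq_norm h"
    using quad_maximiser[OF ne] by blast
  note ev = maximiser_eigenvector[OF z(2,3), unfolded nbr_sum_def]
  have nz: "\<exists>v\<in>pverts G. z v \<noteq> 0" using z(2) unfolding sq_norm_def by (metis power_zero_numeral sum.neutral zero_neq_one)
  then obtain v0 where "v0 \<in> pverts G" "z v0 \<noteq> 0" by blast
  then have "\<bar>quad_form z\<bar> \<le> graph_spectral_radius G"
    by (rule eigenvalue_le_spectral_radius[OF G _ _ ev])
  then have le: "quad_form z \<le> graph_spectral_radius G" by simp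
  obtain vs where vs: "distinct vs" "set vs = pverts G"
    using finite_distinct_list[OF finite_V] by blast
  let ?M = "adjacency_mat vs G"
  have M: "?M \<in> carrier_mat (length vs) (length vs)" by (simp add: adjacency_mat_def)
  have n: "0 < length vs" using ne vs by force
  obtain k where k: "eigenvalue ?M k" "graph_spectral_radius G = cmod k"
    using spectral_radius_mem_max(1)[OF M n] graph_spectral_radius_eq[OF vs]
    unfolding spectrum_def by auto
  obtain f where f: "\<exists>v\<in>pverts G. f v \<noteq> 0"
    "\<forall>v\<in>pverts G. (\<Sum>w\<in>nbs (pverts G) v. f w) = k * f v"
    using k(1) unfolding eigenvalue_graph[OF G vs] by blast
  let ?h = "\<lambda>v. cmod (f v)"
  have "cmod k * sq_norm ?h = (\<Sum>v\<in>pverts G. ?h v * (cmod k * ?h v))"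
    unfolding sq_norm_def sum_distrib_left by (rule sum.cong) (auto simp: power2_eq_square)
  also have "\<dots> \<le> quad_form ?h" unfolding quad_form_def
  proof (intro sum_mono mult_left_mono)
    fix v assume "v \<in> pverts G"
    then have "cmod k * ?h v = cmod (\<Sum>w\<in>nbs (pverts G) v. f w)" using f(2) by (simp add: norm_mult)
    also have "\<dots> \<le> nbr_sum ?h v" unfolding nbr_sum_def by (rule norm_sum)
    finally show "cmod k * ?h v \<le> nbr_sum ?h v" .
  qed simp
  also have "\<dots> \<le> quad_form z * sq_norm ?h" by (rule z(3))
  finally have "cmod k * sq_norm ?h \<le> quad_form z * sq_norm ?h" .
  moreover have "0 < sq_norm ?h"
  proof -
    obtain v where "v \<in> pverts G" "f v \<noteq> 0" using f(1) by blast
    then show ?thesis unfolding sq_norm_def by (intro sum_pos2[OF finite_V, of v]) auto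
  qed
  ultimately have "cmod k \<le> quad_form z" by (rule mult_right_le_imp_le)
  then have "quad_form z = graph_spectral_radius G" using le k(2) by simp
  then show ?thesis using that[OF z(1) nz] ev by simp
qed

section \<open>The extremal graph\<close>

abbreviation K3_tK1 :: "nat \<Rightarrow> (nat + nat) pair_pre_digraph" where
  "K3_tK1 t \<equiv> graph_join (complete_graph 3) (edgeless_graph t)"

lemma verts_K3_tK1: "pverts (K3_tK1 t) = {..<3} <+> {..<t}"
  by (simp add: graph_join_def complete_graph_def edgeless_graph_def)

lemma arcs_K3_tK1:
  "(p, q) \<in> parcs (K3_tK1 t) \<longleftrightarrow> p \<in> {..<3} <+> {..<t} \<and> q \<in> {..<3} <+> {..<t} \<and> p \<noteq> q \<and>
     (p \<in> range Inl \<or> q \<in> range Inl)"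
  by (cases p; cases q) (auto simp: graph_join_def complete_graph_def edgeless_graph_def)

text \<open>The hubs \<open>a, b, c\<close> are numbered by \<open>{..<3}\<close> and the remaining vertices by \<open>{..<t}\<close>. On both sides
  two distinct vertices are adjacent if and only if one of them is a hub.\<close>
lemma K3_join_iso:
  assumes G: "pair_graph G" and K: "simple_graph.K3_join (pverts G) (has_arc G)"
  obtains t where "simple_graph.degsum (has_arc G) (pverts G) = 6 * t + 6" "graph_iso G (K3_tK1 t)"
proof -
  interpret simple_graph "pverts G" "has_arc G" by (rule simple_graph_pair_graph[OF G])
  interpret pair_graph G by fact
  let ?V = "pverts G"
  obtain a b c where abc: "{a, b, c} \<subseteq> ?V" "distinct [a, b, c]" "has_arc G a b" "has_arc G b c" "has_arc G a c"
    and nb: "\<forall>v\<in>?V - {a, b, c}. nbs ?V v = {a, b, c}"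
    using K unfolding K3_join_def by blast
  define T where "T = {a, b, c}"
  define R where "R = ?V - T"
  have VR: "?V = T \<union> R" "T \<inter> R = {}" using abc(1) by (auto simp: T_def R_def)
  have finT: "finite T" "card T = 3" and finR: "finite R" using abc(2) finite_V by (auto simp: T_def R_def)
  have arcR: "has_arc G v w \<longleftrightarrow> w \<in> T" "has_arc G w v \<longleftrightarrow> w \<in> T" if "v \<in> R" for v w
  proof -
    have "nbs ?V v = T" using nb that unfolding R_def T_def by blast
    then show "has_arc G v w \<longleftrightarrow> w \<in> T" using adj_V adj_sym unfolding nbs_def by blast
    then show "has_arc G w v \<longleftrightarrow> w \<in> T" using adj_sym by blast
  qed
  have arcT: "has_arc G v w" if "v \<in> T" "w \<in> T" "v \<noteq> w" for v w
    using that abc adj_sym unfolding T_def by blast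
  have arc_iff: "has_arc G v w \<longleftrightarrow> v \<in> ?V \<and> w \<in> ?V \<and> v \<noteq> w \<and> (v \<in> T \<or> w \<in> T)" for v w
  proof
    assume vw: "has_arc G v w"
    then have "v \<in> ?V" "w \<in> ?V" "v \<noteq> w" using adj_V adj_sym adj_neq by blast+
    moreover have "v \<in> T \<or> w \<in> T" using arcR(1)[of v w] vw VR(1) calculation(1) by blast
    ultimately show "v \<in> ?V \<and> w \<in> ?V \<and> v \<noteq> w \<and> (v \<in> T \<or> w \<in> T)" by blast
  next
    assume vw: "v \<in> ?V \<and> w \<in> ?V \<and> v \<noteq> w \<and> (v \<in> T \<or> w \<in> T)"
    then have "v \<in> T \<or> v \<in> R" "w \<in> T \<or> w \<in> R" using VR(1) by blast+
    then show "has_arc G v w"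
      using arcR(1)[of v w] arcR(2)[of w v] arcT[of v w] vw by metis
  qed
  define t where "t = card R"
  have "dg T v = 2" if "v \<in> T" for v
  proof -
    have "nbs T v = T - {v}" using that arcT adj_irrefl by (auto simp: nbs_def)
    then show ?thesis using that finT by simp
  qed
  then have "degsum T = 6" using finT by (simp add: degsum_def)
  moreover have "dg R v = t" if "v \<in> T" for v
  proof -
    have "nbs R v = R" using that arcR by (auto simp: nbs_def)
    then show ?thesis by (simp add: t_def)
  qed
  then have "(\<Sum>v\<in>T. dg R v) = 3 * t" using finT by simp
  moreover have "dg R v = 0" if "v \<in> R" for v
  proof -
    have "nbs R v = {}" using that arcR VR(2) by (auto simp: nbs_def)
    then show ?thesis by simp
  qed
  then have "degsum R = 0" by (simp add: degsum_def)
  ultimately have ds: "degsum ?V = 6 * t + 6"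
    unfolding VR(1) using degsum_Un[OF finT(1) finR VR(2)] by simp
  have "\<exists>f. bij_betw f T {..<3::nat}" by (rule finite_same_card_bij) (use finT in auto)
  then obtain f where f: "bij_betw f T {..<3::nat}" ..
  have "\<exists>g. bij_betw g R {..<t}" by (rule finite_same_card_bij) (use finR t_def in auto)
  then obtain g where g: "bij_betw g R {..<t}" ..
  define h where "h = (\<lambda>v. if v \<in> T then Inl (f v) else Inr (g v) :: nat + nat)"
  have hL: "h v = (Inl \<circ> f) v" if "v \<in> T" for v using that by (simp add: h_def)
  have hR: "h v = (Inr \<circ> g) v" if "v \<in> R" for v using that VR(2) by (auto simp: h_def)
  have "bij_betw (Inl \<circ> f) T (Inl ` {..<3::nat} :: (nat + nat) set)"
    by (rule bij_betw_trans[OF f]) (simp add: inj_on_imp_bij_betw)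
  then have "bij_betw h T (Inl ` {..<3})" using bij_betw_cong[of T h "Inl \<circ> f"] hL by blast
  moreover have "bij_betw (Inr \<circ> g) R (Inr ` {..<t} :: (nat + nat) set)"
    by (rule bij_betw_trans[OF g]) (simp add: inj_on_imp_bij_betw)
  then have "bij_betw h R (Inr ` {..<t})" using bij_betw_cong[of R h "Inr \<circ> g"] hR by blast
  ultimately have h: "bij_betw h ?V ({..<3} <+> {..<t})"
    unfolding VR(1) Plus_def by (rule bij_betw_combine) auto
  have hT: "h v \<in> range Inl \<longleftrightarrow> v \<in> T" for v by (auto simp: h_def)
  have inj: "h v = h w \<longleftrightarrow> v = w" if "v \<in> ?V" "w \<in> ?V" for v w
    using h that by (auto simp: bij_betw_def inj_on_def)
  have im: "h v \<in> {..<3} <+> {..<t}" if "v \<in> ?V" for v using h that by (auto simp: bij_betw_def)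
  have "parcs (K3_tK1 t) = map_prod h h ` parcs G"
  proof (intro equalityI subsetI)
    fix e assume e: "e \<in> parcs (K3_tK1 t)"
    obtain p q where pq: "e = (p, q)" by (cases e)
    have P: "p \<in> {..<3} <+> {..<t}" "q \<in> {..<3} <+> {..<t}" "p \<noteq> q" "p \<in> range Inl \<or> q \<in> range Inl"
      using e unfolding pq arcs_K3_tK1 by auto
    obtain v w where vw: "v \<in> ?V" "w \<in> ?V" "p = h v" "q = h w"
      using P(1,2) h unfolding bij_betw_def by blast
    have "v \<noteq> w" "v \<in> T \<or> w \<in> T" using P(3,4) unfolding vw(3,4) hT by blast+
    then have "has_arc G v w" unfolding arc_iff using vw(1,2) by blast
    then show "e \<in> map_prod h h ` parcs G" unfolding pq vw by force
  next
    fix e assume "e \<in> map_prod h h ` parcs G"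
    then obtain v w where vw: "e = (h v, h w)" "has_arc G v w" by auto
    then have "v \<in> ?V" "w \<in> ?V" "v \<noteq> w" "v \<in> T \<or> w \<in> T" using arc_iff by auto
    then show "e \<in> parcs (K3_tK1 t)" unfolding vw(1) arcs_K3_tK1 using im inj hT by blast
  qed
  then have "graph_iso G (K3_tK1 t)"
    unfolding graph_iso_iff[OF pair_wf_digraph_axioms] verts_K3_tK1 using h by blast
  with ds show ?thesis by (rule that)
qed

text \<open>With \<open>k = 1 + sqrt (3 * t + 1)\<close>, the vector with entry \<open>k\<close> on the triangle and 3 elsewhere is an
  eigenvector for \<open>k\<close>: the equation on the triangle reads \<open>2 * k + 3 * t = k\<^sup>2\<close>, and the one on the
  independent set is \<open>3 * k = k * 3\<close>.\<close>
lemma spectral_radius_K3_tK1_ge: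
  assumes G: "pair_graph G" and iso: "graph_iso G (K3_tK1 t)"
  shows "1 + sqrt (3 * real t + 1) \<le> graph_spectral_radius G"
proof -
  interpret simple_graph "pverts G" "has_arc G" by (rule simple_graph_pair_graph[OF G])
  interpret pair_graph G by fact
  let ?V = "pverts G"
  define k where "k = 1 + sqrt (3 * real t + 1)"
  have "(k - 1)\<^sup>2 = 3 * real t + 1" by (simp add: k_def)
  then have kk: "2 * k + 3 * real t = k * k" by (simp add: power2_eq_square algebra_simps)
  obtain h where h: "bij_betw h ?V ({..<3} <+> {..<t})" "parcs (K3_tK1 t) = map_prod h h ` parcs G"
    using iso unfolding graph_iso_iff[OF pair_wf_digraph_axioms] verts_K3_tK1 by blast
  have inj: "inj_on h ?V" using h(1) by (simp add: bij_betw_def)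
  have arc_iff: "has_arc G v w \<longleftrightarrow> (h v, h w) \<in> parcs (K3_tK1 t)" if "v \<in> ?V" "w \<in> ?V" for v w
  proof
    assume "(h v, h w) \<in> parcs (K3_tK1 t)"
    then obtain v' w' where "h v = h v'" "h w = h w'" "has_arc G v' w'" unfolding h(2) by auto
    moreover from this have "v = v'" "w = w'"
      using that inj in_arcsD1 in_arcsD2 by (auto dest: inj_onD)
    ultimately show "has_arc G v w" by simp
  qed (auto simp: h(2))
  define y where "y = (\<lambda>p :: nat + nat. case p of Inl _ \<Rightarrow> k | Inr _ \<Rightarrow> 3)"
  have y: "y (Inl i) = k" "y (Inr i) = 3" for i by (simp_all add: y_def)
  have ysum: "(\<Sum>q\<in>{..<3} <+> {..<t}. if (p, q) \<in> parcs (K3_tK1 t) then y q else 0) = k * y p"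
    if p: "p \<in> {..<3} <+> {..<t}" for p
  proof -
    have "(\<Sum>q\<in>{..<3} <+> {..<t}. if (p, q) \<in> parcs (K3_tK1 t) then y q else 0)
        = (\<Sum>i<3. if (p, Inl i) \<in> parcs (K3_tK1 t) then k else 0)
        + (\<Sum>i<t. if (p, Inr i) \<in> parcs (K3_tK1 t) then 3 else 0)"
      by (simp add: sum.Plus y comp_def cong: if_cong)
    also have "\<dots> = k * y p"
    proof (cases p)
      case (Inl i)
      then have i: "i < 3" using p by auto
      have "(\<Sum>j<3. if (p, Inl j) \<in> parcs (K3_tK1 t) then k else 0) = (\<Sum>j\<in>{..<3} - {i}. k)"
        by (rule sum.mono_neutral_cong_right) (use Inl i in \<open>auto simp: arcs_K3_tK1\<close>)
      moreover have "(\<Sum>j<t. if (p, Inr j) \<in> parcs (K3_tK1 t) then 3 else 0) = (\<Sum>j<t. 3 :: real)"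
        by (rule sum.cong) (use Inl i in \<open>auto simp: arcs_K3_tK1\<close>)
      ultimately show ?thesis using Inl i kk by (simp add: y)
    next
      case (Inr i)
      then have i: "i < t" using p by auto
      have "(\<Sum>j<3. if (p, Inl j) \<in> parcs (K3_tK1 t) then k else 0) = (\<Sum>j<3::nat. k)"
        by (rule sum.cong) (use Inr i in \<open>auto simp: arcs_K3_tK1\<close>)
      moreover have "(\<Sum>j<t. if (p, Inr j) \<in> parcs (K3_tK1 t) then 3 else 0) = (\<Sum>j<t. 0 :: real)"
        by (rule sum.cong) (use Inr i in \<open>auto simp: arcs_K3_tK1\<close>)
      ultimately show ?thesis using Inr by (simp add: y)
    qed
    finally show ?thesis .
  qed
  have ev: "(\<Sum>w\<in>nbs ?V v. y (h w)) = k * y (h v)" if v: "v \<in> ?V" for v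
  proof -
    have "(\<Sum>w\<in>nbs ?V v. y (h w)) = (\<Sum>w\<in>?V. if (h v, h w) \<in> parcs (K3_tK1 t) then y (h w) else 0)"
      unfolding sum_nbs_eq_if using arc_iff[OF v] by (intro sum.cong) auto
    also have "\<dots> = (\<Sum>q\<in>{..<3} <+> {..<t}. if (h v, q) \<in> parcs (K3_tK1 t) then y q else 0)"
      by (rule sum.reindex_bij_betw[OF h(1)])
    also have "\<dots> = k * y (h v)" using h(1) v by (intro ysum) (auto simp: bij_betw_def)
    finally show ?thesis .
  qed
  have k0: "0 < k" by (simp add: k_def add_pos_nonneg)
  have "Inl 0 \<in> {..<3::nat} <+> {..<t}" by (rule InlI) simp
  then obtain v where v: "v \<in> ?V" "h v = Inl 0" using h(1) unfolding bij_betw_def by (metis imageE)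
  have "\<bar>k\<bar> \<le> graph_spectral_radius G"
    by (rule eigenvalue_le_spectral_radius[OF G v(1) _ ev]) (use v(2) k0 in \<open>auto simp: y\<close>)
  then show ?thesis using k0 by (simp add: k_def)
qed

text \<open>Rescaling the Perron vector to have largest entry 1 puts the graph in the setting of
  \<open>eigenvalue_bound\<close>. The constant 38 enters through \<open>sqrt (38 - 2) = 6\<close>, which gives \<open>l \<ge> 7\<close>.\<close>
lemma large_spectral_radius:
  assumes m: "m \<ge> 38" and G: "pair_graph G" and card: "card (uedges G) = m"
    and iso: "\<not> (\<exists>v. isolated G v)" and free: "\<not> contains_copy G C6_triangle"
    and large: "1 + sqrt (real m - 2) \<le> graph_spectral_radius G"
  shows "graph_spectral_radius G = 1 + sqrt (real m - 2) \<and> 3 dvd m \<and> graph_iso G (K3_tK1 ((m - 3) div 3))"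
proof -
  interpret simple_graph "pverts G" "has_arc G" by (rule simple_graph_pair_graph[OF G])
  let ?V = "pverts G" and ?l = "graph_spectral_radius G"
  have ds: "degsum ?V = 2 * m" using degsum_uedges[OF G] card by simp
  then have ne: "?V \<noteq> {}" using m by (auto simp: degsum_def)
  obtain z where z: "\<And>v. v \<in> ?V \<Longrightarrow> 0 \<le> z v" "\<exists>v\<in>?V. z v \<noteq> 0"
      "\<And>v. v \<in> ?V \<Longrightarrow> (\<Sum>w\<in>nbs ?V v. z w) = ?l * z v"
    using perron_vector[OF G ne] by blast
  have "Max (z ` ?V) \<in> z ` ?V" using finite_V ne by (intro Max_in) auto
  then obtain u where u: "u \<in> ?V" "z u = Max (z ` ?V)" by auto
  have zu: "z v \<le> z u" if "v \<in> ?V" for v unfolding u(2) using finite_V that by (intro Max_ge) auto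
  have zpos: "0 < z u" using z(1,2) zu by (metis less_le order_trans order_less_le_trans)
  have "sqrt 36 \<le> sqrt (real m - 2)" using m by (intro real_sqrt_le_mono) simp
  moreover have "sqrt 36 = 6" by (rule real_sqrt_unique) auto
  ultimately have six: "6 \<le> sqrt (real m - 2)" by simp
  interpret eigen_star ?V "has_arc G" u "\<lambda>v. z v / z u" ?l
  proof
    show "\<not> has_C6T" using contains_C6_triangle[OF G] free by blast
    show "u \<in> ?V" by (rule u(1))
    show "z u / z u = 1" using zpos by simp
    show "0 \<le> z v / z u" if "v \<in> ?V" for v using z(1)[OF that] zpos by simp
    show "z v / z u \<le> 1" if "v \<in> ?V" for v using zu[OF that] zpos by simp
    show "(\<Sum>w\<in>nbs ?V v. z w / z u) = ?l * (z v / z u)" if "v \<in> ?V" for v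
      using z(3)[OF that] by (simp flip: sum_divide_distrib)
    show "7 \<le> ?l" using large six by linarith
    show "nbs ?V v \<noteq> {}" if "v \<in> ?V" for v
    proof -
      obtain w where "has_arc G v w" using iso \<open>v \<in> ?V\<close> unfolding isolated_def by blast
      then show ?thesis using adj_V adj_sym unfolding nbs_def by blast
    qed
  qed
  have m2: "(sqrt (real m - 2))\<^sup>2 = real m - 2" using m by simp
  have sq: "?l\<^sup>2 - 2 * ?l = (?l - 1)\<^sup>2 - 1" by (simp add: power2_eq_square algebra_simps)
  have "(sqrt (real m - 2))\<^sup>2 \<le> (?l - 1)\<^sup>2"
    by (rule power_mono) (use large six in linarith)+
  then have "degsum ?V / 2 - 3 \<le> ?l\<^sup>2 - 2 * ?l" unfolding sq m2 ds by simp
  from eigenvalue_bound[OF this] have eq: "?l\<^sup>2 - 2 * ?l = real m - 3" and K: "K3_join"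
    using ds by auto
  have "(?l - 1)\<^sup>2 = (sqrt (real m - 2))\<^sup>2" using eq unfolding sq m2 by simp
  then have "?l - 1 = sqrt (real m - 2)"
    by (rule power2_eq_imp_eq) (use large six in linarith)+
  then have l: "?l = 1 + sqrt (real m - 2)" by simp
  obtain t where t: "degsum ?V = 6 * t + 6" "graph_iso G (K3_tK1 t)" by (rule K3_join_iso[OF G K])
  then have "m = 3 * t + 3" using ds by simp
  then have "3 dvd m" "(m - 3) div 3 = t" by simp_all
  with l t show ?thesis by simp
qed

theorem theorem1:
  fixes G :: "'a pair_pre_digraph" and m :: nat
  assumes "m \<ge> 38"
    and "pair_graph G"
    and "card (uedges G) = m"
    and "\<not> (\<exists>v. isolated G v)"
    and "\<not> contains_copy G C6_triangle"
  shows "graph_spectral_radius G \<le> 1 + sqrt (real m - 2)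
    \<and> (graph_spectral_radius G = 1 + sqrt (real m - 2)
       \<longleftrightarrow> 3 dvd m \<and> graph_iso G (graph_join (complete_graph 3) (edgeless_graph ((m - 3) div 3))))"
proof -
  note L = large_spectral_radius[OF assms]
  have le: "graph_spectral_radius G \<le> 1 + sqrt (real m - 2)" using L by linarith
  have ge: "1 + sqrt (real m - 2) \<le> graph_spectral_radius G"
    if d: "3 dvd m" and i: "graph_iso G (K3_tK1 ((m - 3) div 3))"
  proof -
    have "3 dvd m - 3" using d by (simp add: dvd_diff_nat)
    then have "3 * ((m - 3) div 3) = m - 3" by simp
    then have "3 * real ((m - 3) div 3) = real (m - 3)" by (metis of_nat_mult of_nat_numeral)
    then have e: "3 * real ((m - 3) div 3) + 1 = real m - 2" using assms(1) by (simp add: of_nat_diff)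
    show ?thesis using spectral_radius_K3_tK1_ge[OF assms(2) i] unfolding e .
  qed
  show ?thesis
  proof (rule conjI[OF le], rule iffI)
    assume "graph_spectral_radius G = 1 + sqrt (real m - 2)"
    then show "3 dvd m \<and> graph_iso G (K3_tK1 ((m - 3) div 3))" using L by simp
  next
    assume "3 dvd m \<and> graph_iso G (K3_tK1 ((m - 3) div 3))"
    then show "graph_spectral_radius G = 1 + sqrt (real m - 2)" using le ge by (simp add: antisym)
  qed
qed

end
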